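(* Let $A$ be a finite dimensional algebra over a field $k$, and let $(\mathcal{T},\mathcal{F})$ be a torsion pair in $\operatorname{mod} A$. The following are equivalent: (1) $(\mathcal{T},\mathcal{F})$ is a brick-splitting torsion pair; (2) every brick $B\in\operatorname{brick} A$ appears as the label of an arrow in $\operatorname{Hasse}[0,\mathcal{T}]$ or in $\operatorname{Hasse}[\mathcal{T},\operatorname{mod} A]$; (3) $\mathcal{T}$ is a left modular element of the lattice $\operatorname{tors} A$.
   Context: Algebras are associative and unital (and, without loss of generality, basic). $\operatorname{mod} A$ is the category of finitely generated left $A$-modules. A brick is a module $X\in\operatorname{mod} A$ such that $\operatorname{End}_A(X)$ is a division algebra; $\operatorname{brick} A$ is the set of isomorphism classes of bricks. A torsion pair $(\mathcal{T},\mathcal{F})$ in $\operatorname{mod} A$ is brick-splitting if every brick belongs to $\mathcal{T}$ or to $\mathcal{F}$. $\operatorname{tors} A$ is the set of torsion classes in $\operatorname{mod} A$ ordered by inclusion; it is a complete lattice with meet given by intersection. For $\mathcal{U}\subseteq\mathcal{T}$ in $\operatorname{tors} A$, $[\mathcal{U},\mathcal{T}]$ is the corresponding interval and $\operatorname{Hasse}[\mathcal{U},\mathcal{T}]$ is its Hasse quiver, whose arrows correspond to the cover relations. For each cover relation $\mathcal{U}\subsetneq\mathcal{T}$ in $\operatorname{tors} A$ there is a unique brick (up to isomorphism) in $\mathcal{T}\cap\mathcal{U}^{\perp}$, where $\mathcal{U}^\perp=\{X\in \operatorname{mod} A\mid \operatorname{Hom}_A(U,X)=0\ \forall U\in\mathcal{U}\}$;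 this brick is the label of the corresponding arrow. An element $x$ of a lattice $L$ is left modular if $(y\vee x)\wedge z=y\vee(x\wedge z)$ for all $y\le z$ in $L$. *)

theory Defs
  imports "HOL-Algebra.Algebra"
begin

section \<open>Finite dimensional algebras\<close>

text \<open>The library locale \<^locale>\<open>algebra\<close> covers commutative algebras only. As there, the record of
  \<open>A\<close> carries both the ring structure and the scalar multiplication by \<open>K\<close>.\<close>

definition finitely_generated :: "('a, 'e) ring_scheme \<Rightarrow> ('a, 'm, 'f) module_scheme \<Rightarrow> bool" where
  "finitely_generated R M \<longleftrightarrow>
     (\<exists>S. finite S \<and> S \<subseteq> carrier M \<and>
       (\<forall>x\<in>carrier M. \<exists>c \<in> S \<rightarrow> carrier R. x = (\<Oplus>\<^bsub>M\<^esub>s\<in>S. c s \<odot>\<^bsub>M\<^esub> s)))"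

locale fin_dim_algebra = field K + module K A + A: ring A
  for K :: "('k, 'e) ring_scheme" (structure) and A :: "('k, 'a, 'f) module_scheme" +
  assumes smult_mult_left:
      "\<lbrakk>c \<in> carrier K; x \<in> carrier A; y \<in> carrier A\<rbrakk>
        \<Longrightarrow> (c \<odot>\<^bsub>A\<^esub> x) \<otimes>\<^bsub>A\<^esub> y = c \<odot>\<^bsub>A\<^esub> (x \<otimes>\<^bsub>A\<^esub> y)"
    and smult_mult_right:
      "\<lbrakk>c \<in> carrier K; x \<in> carrier A; y \<in> carrier A\<rbrakk>
        \<Longrightarrow> x \<otimes>\<^bsub>A\<^esub> (c \<odot>\<^bsub>A\<^esub> y) = c \<odot>\<^bsub>A\<^esub> (x \<otimes>\<^bsub>A\<^esub> y)"
    and fin_dim: "finitely_generated K A"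


section \<open>Finitely generated left modules\<close>

text \<open>These are the axioms of \<^locale>\<open>module\<close> without commutativity of the scalars. The fields
  \<^const>\<open>mult\<close> and \<^const>\<open>one\<close> of a module record play no role.\<close>

locale left_module = R?: ring R + M?: abelian_group M
  for R :: "('a, 'e) ring_scheme" (structure) and M :: "('a, 'm, 'f) module_scheme" (structure) +
  assumes smult_closed [simp, intro]:
      "\<lbrakk>a \<in> carrier R; x \<in> carrier M\<rbrakk> \<Longrightarrow> a \<odot>\<^bsub>M\<^esub> x \<in> carrier M"
    and smult_l_distr:
      "\<lbrakk>a \<in> carrier R; b \<in> carrier R; x \<in> carrier M\<rbrakk>
        \<Longrightarrow> (a \<oplus> b) \<odot>\<^bsub>M\<^esub> x = a \<odot>\<^bsub>M\<^esub> x \<oplus>\<^bsub>M\<^esub> b \<odot>\<^bsub>M\<^esub> x"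
    and smult_r_distr:
      "\<lbrakk>a \<in> carrier R; x \<in> carrier M; y \<in> carrier M\<rbrakk>
        \<Longrightarrow> a \<odot>\<^bsub>M\<^esub> (x \<oplus>\<^bsub>M\<^esub> y) = a \<odot>\<^bsub>M\<^esub> x \<oplus>\<^bsub>M\<^esub> a \<odot>\<^bsub>M\<^esub> y"
    and smult_assoc:
      "\<lbrakk>a \<in> carrier R; b \<in> carrier R; x \<in> carrier M\<rbrakk>
        \<Longrightarrow> (a \<otimes> b) \<odot>\<^bsub>M\<^esub> x = a \<odot>\<^bsub>M\<^esub> (b \<odot>\<^bsub>M\<^esub> x)"
    and smult_one [simp]:
      "x \<in> carrier M \<Longrightarrow> \<one> \<odot>\<^bsub>M\<^esub> x = x"

text \<open>Homomorphisms are extensional functions, so that equality in \<open>Hom\<close> is equality on the carrier.\<close>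

definition mod_hom ::
    "('a, 'e) ring_scheme \<Rightarrow> ('a, 'm, 'f) module_scheme \<Rightarrow> ('a, 'n, 'g) module_scheme \<Rightarrow> ('m \<Rightarrow> 'n) set" where
  "mod_hom R M N =
     {f \<in> carrier M \<rightarrow>\<^sub>E carrier N.
        (\<forall>x\<in>carrier M. \<forall>y\<in>carrier M. f (x \<oplus>\<^bsub>M\<^esub> y) = f x \<oplus>\<^bsub>N\<^esub> f y) \<and>
        (\<forall>a\<in>carrier R. \<forall>x\<in>carrier M. f (a \<odot>\<^bsub>M\<^esub> x) = a \<odot>\<^bsub>N\<^esub> f x)}"

text \<open>A class of modules must be a set over one fixed type. The element type \<^typ>\<open>'a list\<close> loses nothing:
  a finitely generated module is in bijection with a set of coefficient lists, so every finitely
  generated left module over any element type has an isomorphic copy here (lemma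
  \<open>fg_module_representable\<close> below).\<close>

definition mod_cat :: "('a, 'e) ring_scheme \<Rightarrow> ('a, 'a list) module set" where
  "mod_cat R = {M. left_module R M \<and> finitely_generated R M}"

definition is_zero_hom :: "('a, 'm, 'f) module_scheme \<Rightarrow> ('a, 'n, 'g) module_scheme \<Rightarrow> ('m \<Rightarrow> 'n) \<Rightarrow> bool" where
  "is_zero_hom M N f \<longleftrightarrow> f = (\<lambda>x\<in>carrier M. \<zero>\<^bsub>N\<^esub>)"

abbreviation hom_zero ::
    "('a, 'e) ring_scheme \<Rightarrow> ('a, 'm, 'f) module_scheme \<Rightarrow> ('a, 'n, 'g) module_scheme \<Rightarrow> bool" where
  "hom_zero R M N \<equiv> \<forall>f\<in>mod_hom R M N. is_zero_hom M N f"

definition zero_mods :: "('a, 'e) ring_scheme \<Rightarrow> ('a, 'a list) module set" where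
  "zero_mods R = {M \<in> mod_cat R. carrier M = {\<zero>\<^bsub>M\<^esub>}}"


section \<open>Bricks\<close>

locale division_alg = ring D for D (structure) +
  assumes one_not_zero: "\<one> \<noteq> \<zero>"
    and division_Units: "Units D = carrier D - {\<zero>}"

definition End_ring :: "('a, 'e) ring_scheme \<Rightarrow> ('a, 'm, 'f) module_scheme \<Rightarrow> ('m \<Rightarrow> 'm) ring" where
  "End_ring R M =
     \<lparr>carrier = mod_hom R M M,
      monoid.mult = compose (carrier M),
      monoid.one = (\<lambda>x\<in>carrier M. x),
      ring.zero = (\<lambda>x\<in>carrier M. \<zero>\<^bsub>M\<^esub>),
      ring.add = (\<lambda>f g. \<lambda>x\<in>carrier M. f x \<oplus>\<^bsub>M\<^esub> g x)\<rparr>"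

text \<open>Bricks are modules rather than isomorphism classes; everything said about them below is
  invariant under isomorphism.\<close>

definition bricks :: "('a, 'e) ring_scheme \<Rightarrow> ('a, 'a list) module set" where
  "bricks R = {B \<in> mod_cat R. division_alg (End_ring R B)}"


section \<open>Torsion pairs and the lattice of torsion classes\<close>

definition right_perp :: "('a, 'e) ring_scheme \<Rightarrow> ('a, 'a list) module set \<Rightarrow> ('a, 'a list) module set" where
  "right_perp R \<U> = {M \<in> mod_cat R. \<forall>N\<in>\<U>. hom_zero R N M}"

definition left_perp :: "('a, 'e) ring_scheme \<Rightarrow> ('a, 'a list) module set \<Rightarrow> ('a, 'a list) module set" where
  "left_perp R \<V> = {M \<in> mod_cat R. \<forall>N\<in>\<V>. hom_zero R M N}"

definition torsion_pair ::
    "('a, 'e) ring_scheme \<Rightarrow> ('a, 'a list) module set \<Rightarrow> ('a, 'a list) module set \<Rightarrow> bool" where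
  "torsion_pair R \<T> \<F> \<longleftrightarrow> \<T> = left_perp R \<F> \<and> \<F> = right_perp R \<T>"

definition brick_splitting ::
    "('a, 'e) ring_scheme \<Rightarrow> ('a, 'a list) module set \<Rightarrow> ('a, 'a list) module set \<Rightarrow> bool" where
  "brick_splitting R \<T> \<F> \<longleftrightarrow> torsion_pair R \<T> \<F> \<and> (\<forall>B\<in>bricks R. B \<in> \<T> \<or> B \<in> \<F>)"

definition torsion_classes :: "('a, 'e) ring_scheme \<Rightarrow> ('a, 'a list) module set set" where
  "torsion_classes R = {\<T>. \<exists>\<F>. torsion_pair R \<T> \<F>}"

definition tors :: "('a, 'e) ring_scheme \<Rightarrow> ('a, 'a list) module set gorder" where
  "tors R = \<lparr>carrier = torsion_classes R, eq = (=), le = (\<subseteq>)\<rparr>"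

definition left_modular :: "('c, 'd) gorder_scheme \<Rightarrow> 'c \<Rightarrow> bool" where
  "left_modular L x \<longleftrightarrow> x \<in> carrier L \<and>
     (\<forall>y\<in>carrier L. \<forall>z\<in>carrier L. y \<sqsubseteq>\<^bsub>L\<^esub> z \<longrightarrow>
        (y \<squnion>\<^bsub>L\<^esub> x) \<sqinter>\<^bsub>L\<^esub> z = y \<squnion>\<^bsub>L\<^esub> (x \<sqinter>\<^bsub>L\<^esub> z))"


section \<open>Hasse quivers and brick labels\<close>

definition hasse_arrows :: "('c, 'd) gorder_scheme \<Rightarrow> ('c \<times> 'c) set" where
  "hasse_arrows L =
     {(x, y). x \<in> carrier L \<and> y \<in> carrier L \<and> y \<sqsubset>\<^bsub>L\<^esub> x \<and>
        \<not> (\<exists>z\<in>carrier L. y \<sqsubset>\<^bsub>L\<^esub> z \<and> z \<sqsubset>\<^bsub>L\<^esub> x)}"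

definition tors_interval ::
    "('a, 'e) ring_scheme \<Rightarrow> ('a, 'a list) module set \<Rightarrow> ('a, 'a list) module set
      \<Rightarrow> ('a, 'a list) module set gorder" where
  "tors_interval R \<U> \<T> = (tors R)\<lparr>carrier := \<lbrace>\<U>..\<T>\<rbrace>\<^bsub>tors R\<^esub>\<rparr>"

text \<open>An arrow \<open>\<T> \<rightarrow> \<U>\<close> of a Hasse quiver means \<open>\<U> \<subset> \<T>\<close>.\<close>

definition labels ::
    "('a, 'e) ring_scheme \<Rightarrow> ('a, 'a list) module
      \<Rightarrow> ('a, 'a list) module set \<times> ('a, 'a list) module set \<Rightarrow> bool" where
  "labels R B = (\<lambda>(\<T>, \<U>). B \<in> bricks R \<and> B \<in> \<T> \<inter> right_perp R \<U>)"


section \<open>Adequacy of the definitions\<close>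

lemma fg_module_representable:
  fixes R :: "('a, 'e) ring_scheme" and M :: "('a, 'm, 'f) module_scheme"
  assumes "left_module R M" and "finitely_generated R M"
  shows "\<exists>N\<in>mod_cat R. \<exists>f\<in>mod_hom R M N. bij_betw f (carrier M) (carrier N)"
proof -
  interpret left_module R M by fact
  obtain S where S: "finite S" "S \<subseteq> carrier M"
    and gen: "\<forall>x\<in>carrier M. \<exists>c \<in> S \<rightarrow> carrier R. x = (\<Oplus>\<^bsub>M\<^esub>s\<in>S. c s \<odot>\<^bsub>M\<^esub> s)"
    using assms(2) by (auto simp: finitely_generated_def)
  obtain ss where ss: "set ss = S" using S(1) finite_list by blast
  obtain c where c: "\<And>x. x \<in> carrier M \<Longrightarrow> c x \<in> S \<rightarrow> carrier R"
    "\<And>x. x \<in> carrier M \<Longrightarrow> x = (\<Oplus>\<^bsub>M\<^esub>s\<in>S. c x s \<odot>\<^bsub>M\<^esub> s)"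
    using gen by metis
  define e where "e x = map (c x) ss" for x
  have inj: "inj_on e (carrier M)"
  proof (rule inj_onI)
    fix x y assume xy: "x \<in> carrier M" "y \<in> carrier M" "e x = e y"
    then have eq: "\<forall>s\<in>S. c x s = c y s" by (auto simp: e_def ss[symmetric])
    have "(\<Oplus>\<^bsub>M\<^esub>s\<in>S. c x s \<odot>\<^bsub>M\<^esub> s) = (\<Oplus>\<^bsub>M\<^esub>s\<in>S. c y s \<odot>\<^bsub>M\<^esub> s)"
      by (rule M.finsum_cong') (use eq c(1)[OF xy(2)] S(2) in \<open>auto simp: Pi_iff subset_iff\<close>)
    then show "x = y" using c(2) xy by metis
  qed
  define d where "d = the_inv_into (carrier M) e"
  have de [simp]: "d (e x) = x" if "x \<in> carrier M" for x
    using that inj by (simp add: d_def the_inv_into_f_f)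
  define N :: "('a, 'a list) module" where
    "N = \<lparr>carrier = e ` carrier M, monoid.mult = undefined, monoid.one = undefined,
          ring.zero = e \<zero>\<^bsub>M\<^esub>, ring.add = (\<lambda>u v. e (d u \<oplus>\<^bsub>M\<^esub> d v)), smult = (\<lambda>a u. e (a \<odot>\<^bsub>M\<^esub> d u))\<rparr>"
  have N [simp]: "carrier N = e ` carrier M" "\<zero>\<^bsub>N\<^esub> = e \<zero>\<^bsub>M\<^esub>"
    "\<And>u v. u \<oplus>\<^bsub>N\<^esub> v = e (d u \<oplus>\<^bsub>M\<^esub> d v)" "\<And>a u. a \<odot>\<^bsub>N\<^esub> u = e (a \<odot>\<^bsub>M\<^esub> d u)"
    by (simp_all add: N_def)
  have grp: "abelian_group N"
  proof (rule abelian_groupI)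
    fix u assume "u \<in> carrier N"
    then obtain x where x: "x \<in> carrier M" "u = e x" by auto
    then show "\<exists>v\<in>carrier N. v \<oplus>\<^bsub>N\<^esub> u = \<zero>\<^bsub>N\<^esub>"
      by (auto intro!: bexI[of _ "\<ominus>\<^bsub>M\<^esub> x"] simp: M.l_neg)
  qed (auto simp: M.a_ac)
  have lm: "left_module R N"
    by (intro left_module.intro left_module_axioms.intro grp R.ring_axioms)
       (auto simp: smult_l_distr smult_r_distr smult_assoc)
  interpret N: left_module R N by fact
  have sum: "(\<Oplus>\<^bsub>N\<^esub>t\<in>F. e (f t)) = e (\<Oplus>\<^bsub>M\<^esub>t\<in>F. f t)"
    if "finite F" "f \<in> F \<rightarrow> carrier M" for F and f :: "'m \<Rightarrow> 'm"
    using that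
  proof (induction F)
    case (insert t F)
    then have "(\<Oplus>\<^bsub>N\<^esub>t\<in>insert t F. e (f t)) = e (f t) \<oplus>\<^bsub>N\<^esub> (\<Oplus>\<^bsub>N\<^esub>t\<in>F. e (f t))"
      by (intro N.finsum_insert) auto
    also have "\<dots> = e (f t \<oplus>\<^bsub>M\<^esub> (\<Oplus>\<^bsub>M\<^esub>t\<in>F. f t))"
      using insert by (auto simp: Pi_iff)
    also have "f t \<oplus>\<^bsub>M\<^esub> (\<Oplus>\<^bsub>M\<^esub>t\<in>F. f t) = (\<Oplus>\<^bsub>M\<^esub>t\<in>insert t F. f t)"
      using insert by (intro M.finsum_insert[symmetric]) auto
    finally show ?case .
  qed simp
  have fg: "finitely_generated R N"
    unfolding finitely_generated_def
  proof (intro exI[of _ "e ` S"] conjI ballI)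
    show "finite (e ` S)" "e ` S \<subseteq> carrier N" using S by auto
    fix u assume "u \<in> carrier N"
    then obtain x where x: "x \<in> carrier M" "u = e x" by auto
    have injS: "inj_on e S" using inj S(2) by (rule inj_on_subset)
    have dS: "d (e s) = s" if "s \<in> S" for s using that S(2) by auto
    have "(\<Oplus>\<^bsub>N\<^esub>t\<in>e ` S. c x (d t) \<odot>\<^bsub>N\<^esub> t) = (\<Oplus>\<^bsub>N\<^esub>s\<in>S. c x (d (e s)) \<odot>\<^bsub>N\<^esub> e s)"
      by (rule N.finsum_reindex[OF _ injS]) (use c(1)[OF x(1)] S(2) dS in \<open>auto simp: Pi_iff\<close>)
    also have "\<dots> = (\<Oplus>\<^bsub>N\<^esub>s\<in>S. e (c x s \<odot>\<^bsub>M\<^esub> s))"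
      by (rule N.finsum_cong') (use c(1)[OF x(1)] S(2) dS in \<open>auto simp: Pi_iff\<close>)
    also have "\<dots> = e (\<Oplus>\<^bsub>M\<^esub>s\<in>S. c x s \<odot>\<^bsub>M\<^esub> s)"
      by (rule sum) (use c(1)[OF x(1)] S in \<open>auto simp: Pi_iff\<close>)
    also have "\<dots> = u" using c(2)[OF x(1)] x(2) by simp
    finally show "\<exists>b\<in>e ` S \<rightarrow> carrier R. u = (\<Oplus>\<^bsub>N\<^esub>t\<in>e ` S. b t \<odot>\<^bsub>N\<^esub> t)"
      using c(1)[OF x(1)] dS by (intro bexI[of _ "\<lambda>t. c x (d t)"]) (auto simp: Pi_iff)
  qed
  have "N \<in> mod_cat R" using lm fg by (simp add: mod_cat_def)
  moreover have "restrict e (carrier M) \<in> mod_hom R M N" by (auto simp: mod_hom_def)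
  moreover have "bij_betw (restrict e (carrier M)) (carrier M) (carrier N)"
    using inj by (simp add: bij_betw_def)
  ultimately show ?thesis by blast
qed

lemma (in left_module) End_ring_ring: "ring (End_ring R M)"
proof -
  have E [simp]: "carrier (End_ring R M) = mod_hom R M M"
    "f \<otimes>\<^bsub>End_ring R M\<^esub> g = compose (carrier M) f g"
    "\<one>\<^bsub>End_ring R M\<^esub> = (\<lambda>x\<in>carrier M. x)"
    "\<zero>\<^bsub>End_ring R M\<^esub> = (\<lambda>x\<in>carrier M. \<zero>\<^bsub>M\<^esub>)"
    "f \<oplus>\<^bsub>End_ring R M\<^esub> g = (\<lambda>x\<in>carrier M. f x \<oplus>\<^bsub>M\<^esub> g x)" for f g
    by (simp_all add: End_ring_def)
  have z: "a \<odot>\<^bsub>M\<^esub> \<zero>\<^bsub>M\<^esub> = \<zero>\<^bsub>M\<^esub>" if "a \<in> carrier R" for a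
    using smult_r_distr[of a "\<zero>\<^bsub>M\<^esub>" "\<zero>\<^bsub>M\<^esub>"] that
    by (metis M.add.r_cancel_one' M.l_zero M.zero_closed smult_closed)
  have sm: "a \<odot>\<^bsub>M\<^esub> (\<ominus>\<^bsub>M\<^esub> y) = \<ominus>\<^bsub>M\<^esub> (a \<odot>\<^bsub>M\<^esub> y)" if "a \<in> carrier R" "y \<in> carrier M" for a y
  proof -
    have "a \<odot>\<^bsub>M\<^esub> (\<ominus>\<^bsub>M\<^esub> y) \<oplus>\<^bsub>M\<^esub> a \<odot>\<^bsub>M\<^esub> y = \<zero>\<^bsub>M\<^esub>"
      using smult_r_distr[of a "\<ominus>\<^bsub>M\<^esub> y" y] that z by (simp add: M.l_neg)
    then show ?thesis using that by (simp add: M.minus_equality)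
  qed
  have hc: "f x \<in> carrier M" if "f \<in> mod_hom R M M" "x \<in> carrier M" for f x
    using that by (auto simp: mod_hom_def)
  have ha: "f (x \<oplus>\<^bsub>M\<^esub> y) = f x \<oplus>\<^bsub>M\<^esub> f y"
    if "f \<in> mod_hom R M M" "x \<in> carrier M" "y \<in> carrier M" for f x y
    using that by (simp add: mod_hom_def)
  have hs: "f (a \<odot>\<^bsub>M\<^esub> x) = a \<odot>\<^bsub>M\<^esub> f x"
    if "f \<in> mod_hom R M M" "a \<in> carrier R" "x \<in> carrier M" for f a x
    using that by (simp add: mod_hom_def)
  have he: "(\<lambda>x\<in>carrier M. f x) = f" if "f \<in> mod_hom R M M" for f
    using that by (simp add: mod_hom_def PiE_iff extensional_restrict)
  have ext: "(\<lambda>x\<in>carrier M. f x) \<in> mod_hom R M M"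
    if "\<And>x. x \<in> carrier M \<Longrightarrow> f x \<in> carrier M"
      "\<And>x y. \<lbrakk>x \<in> carrier M; y \<in> carrier M\<rbrakk> \<Longrightarrow> f (x \<oplus>\<^bsub>M\<^esub> y) = f x \<oplus>\<^bsub>M\<^esub> f y"
      "\<And>a x. \<lbrakk>a \<in> carrier R; x \<in> carrier M\<rbrakk> \<Longrightarrow> f (a \<odot>\<^bsub>M\<^esub> x) = a \<odot>\<^bsub>M\<^esub> f x" for f
    using that by (simp add: mod_hom_def)
  have add: "(\<lambda>x\<in>carrier M. f x \<oplus>\<^bsub>M\<^esub> g x) \<in> mod_hom R M M"
    if "f \<in> mod_hom R M M" "g \<in> mod_hom R M M" for f g
    by (rule ext) (simp_all add: that hc ha hs smult_r_distr M.a_ac)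
  have neg: "(\<lambda>x\<in>carrier M. \<ominus>\<^bsub>M\<^esub> f x) \<in> mod_hom R M M" if "f \<in> mod_hom R M M" for f
    by (rule ext) (simp_all add: that hc ha hs sm M.minus_add)
  have comp: "compose (carrier M) f g \<in> mod_hom R M M"
    if "f \<in> mod_hom R M M" "g \<in> mod_hom R M M" for f g
    unfolding compose_def by (rule ext) (simp_all add: that hc ha hs)
  have id: "(\<lambda>x\<in>carrier M. x) \<in> mod_hom R M M" by (rule ext) simp_all
  have zero: "(\<lambda>x\<in>carrier M. \<zero>\<^bsub>M\<^esub>) \<in> mod_hom R M M" by (rule ext) (simp_all add: z)
  show ?thesis
  proof (rule ringI)
    show "abelian_group (End_ring R M)"
    proof (rule abelian_groupI)
      fix f assume f: "f \<in> carrier (End_ring R M)"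
      then show "\<exists>g\<in>carrier (End_ring R M). g \<oplus>\<^bsub>End_ring R M\<^esub> f = \<zero>\<^bsub>End_ring R M\<^esub>"
        by (intro bexI[of _ "\<lambda>x\<in>carrier M. \<ominus>\<^bsub>M\<^esub> f x"]) (simp_all add: hc neg M.l_neg cong: restrict_cong)
      show "\<zero>\<^bsub>End_ring R M\<^esub> \<oplus>\<^bsub>End_ring R M\<^esub> f = f"
        using f hc[of f] he[of f] by (simp cong: restrict_cong)
    qed (simp_all add: hc M.a_ac add zero cong: restrict_cong)
    show "Group.monoid (End_ring R M)"
    proof (rule monoidI)
      fix f assume "f \<in> carrier (End_ring R M)"
      then show "\<one>\<^bsub>End_ring R M\<^esub> \<otimes>\<^bsub>End_ring R M\<^esub> f = f" "f \<otimes>\<^bsub>End_ring R M\<^esub> \<one>\<^bsub>End_ring R M\<^esub> = f"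
        using hc[of f] he[of f] by (simp_all add: compose_def cong: restrict_cong)
    qed (simp_all add: comp id, simp add: hc compose_def cong: restrict_cong)
  qed (simp_all add: hc ha compose_def cong: restrict_cong)
qed

lemma tors_complete_lattice:
  shows "complete_lattice (tors R)"
proof -
  have sub: "\<V> \<subseteq> right_perp R (left_perp R \<V>)" if "\<V> \<subseteq> mod_cat R" for \<V>
    using that by (auto simp: right_perp_def left_perp_def)
  have lperp: "left_perp R \<V> \<in> torsion_classes R" if "\<V> \<subseteq> mod_cat R" for \<V>
  proof -
    have "left_perp R (right_perp R (left_perp R \<V>)) = left_perp R \<V>"
      using sub[OF that] by (auto simp: right_perp_def left_perp_def)
    then show ?thesis by (auto simp: torsion_classes_def torsion_pair_def)
  qed
  have closed: "left_perp R (right_perp R \<T>) = \<T>" if "\<T> \<in> torsion_classes R" for \<T>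
    using that by (auto simp: torsion_classes_def torsion_pair_def)
  interpret partial_order "tors R"
    by unfold_locales (auto simp: tors_def)
  show ?thesis
  proof (rule complete_latticeI)
    fix \<A> assume "\<A> \<subseteq> carrier (tors R)"
    then have A: "\<A> \<subseteq> torsion_classes R" by (simp add: tors_def)
    have Am: "\<T> \<subseteq> mod_cat R" if "\<T> \<in> \<A>" for \<T>
      using closed[of \<T>] A that by (auto simp: left_perp_def)
    define s where "s = left_perp R (right_perp R (\<Union>\<A>))"
    have "s \<in> torsion_classes R" unfolding s_def by (rule lperp) (auto simp: right_perp_def)
    moreover have "\<T> \<subseteq> s" if "\<T> \<in> \<A>" for \<T>
      using that Am by (auto simp: s_def right_perp_def left_perp_def)
    moreover have "s \<subseteq> \<U>" if "\<U> \<in> torsion_classes R" "\<forall>\<T>\<in>\<A>. \<T> \<subseteq> \<U>" for \<U>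
    proof -
      have "s \<subseteq> left_perp R (right_perp R \<U>)"
        using that(2) unfolding s_def right_perp_def left_perp_def by blast
      then show ?thesis using closed[OF that(1)] by simp
    qed
    ultimately show "\<exists>s. is_lub (tors R) s \<A>"
      using A by (intro exI[of _ s]) (simp add: least_def Upper_def tors_def, blast)
    define i where "i = left_perp R (\<Union>\<T>\<in>\<A>. right_perp R \<T>)"
    have "i \<in> torsion_classes R" unfolding i_def by (rule lperp) (auto simp: right_perp_def)
    moreover have "i \<subseteq> \<T>" if "\<T> \<in> \<A>" for \<T>
    proof -
      have "i \<subseteq> left_perp R (right_perp R \<T>)"
        using that unfolding i_def left_perp_def by blast
      then show ?thesis using closed[of \<T>] A that by auto
    qed
    moreover have "\<U> \<subseteq> i" if "\<U> \<in> torsion_classes R" "\<forall>\<T>\<in>\<A>. \<U> \<subseteq> \<T>" for \<U>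
    proof -
      have "\<U> \<subseteq> mod_cat R" using closed[OF that(1)] by (auto simp: left_perp_def)
      then show ?thesis using that(2) unfolding i_def right_perp_def left_perp_def by blast
    qed
    ultimately show "\<exists>i. is_glb (tors R) i \<A>"
      using A by (intro exI[of _ i]) (simp add: greatest_def Lower_def tors_def, blast)
  qed
qed

end

theory Submission
  imports Defs
begin

text \<open>For torsion classes \<open>\<T>\<close> and \<open>\<U>\<close> with \<open>\<not> \<T> \<subseteq> \<U>\<close>, a module of minimal dimension in
  \<open>\<T> - \<U>\<close> is a brick in \<open>\<T> \<inter> \<U>\<^sup>\<bottom>\<close>. If left modularity fails at \<open>\<T>\<close> for \<open>\<Y> \<subseteq> \<Z>\<close>, such a brick
  in the difference of the two sides can be neither in \<open>\<T>\<close> nor in \<open>\<F>\<close>.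

  The smallest torsion class \<open>T(B)\<close> containing a brick \<open>B\<close> has the unique lower cover
  \<open>T(B) \<inter> \<^sup>\<bottom>B\<close>, with label \<open>B\<close>; dually \<open>\<^sup>\<bottom>B\<close> has a unique upper cover, again with label \<open>B\<close>.
  These are the arrows in (2). If \<open>B\<close> is neither in \<open>\<T>\<close> nor in \<open>\<F>\<close>, then \<open>\<Y> = T(B) \<inter> \<^sup>\<bottom>B\<close> and
  \<open>\<Z> = T(B)\<close> violate left modularity: \<open>\<T> \<inter> \<Z> \<subseteq> \<Y>\<close>, while \<open>B\<close> lies in \<open>\<Y> \<squnion> \<T>\<close> as an extension of
  a proper quotient, which is in \<open>\<Y>\<close>, by the image of some module of \<open>\<T>\<close>.\<close>

section \<open>Spans\<close>

lemma (in left_module) smult_zero [simp]: "a \<in> carrier R \<Longrightarrow> a \<odot>\<^bsub>M\<^esub> \<zero>\<^bsub>M\<^esub> = \<zero>\<^bsub>M\<^esub>"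
  using smult_r_distr[of a "\<zero>\<^bsub>M\<^esub>" "\<zero>\<^bsub>M\<^esub>"]
  by (metis M.add.r_cancel_one' M.l_zero M.zero_closed smult_closed)

lemma (in left_module) zero_smult [simp]: "x \<in> carrier M \<Longrightarrow> \<zero> \<odot>\<^bsub>M\<^esub> x = \<zero>\<^bsub>M\<^esub>"
  using smult_l_distr[of \<zero> \<zero> x]
  by (metis M.add.r_cancel_one' R.l_zero R.zero_closed smult_closed)

text \<open>Negation is the action of a scalar, so whatever respects addition and scalars also
  respects differences.\<close>

lemma (in left_module) smult_minus_one: "x \<in> carrier M \<Longrightarrow> (\<ominus> \<one>) \<odot>\<^bsub>M\<^esub> x = \<ominus>\<^bsub>M\<^esub> x"
  using smult_l_distr[of "\<ominus> \<one>" \<one> x] by (simp add: R.l_neg M.minus_equality)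

lemma (in left_module) smult_minus:
  assumes "a \<in> carrier R" "x \<in> carrier M"
  shows "a \<odot>\<^bsub>M\<^esub> (\<ominus>\<^bsub>M\<^esub> x) = \<ominus>\<^bsub>M\<^esub> (a \<odot>\<^bsub>M\<^esub> x)"
  using smult_r_distr[of a "\<ominus>\<^bsub>M\<^esub> x" x] assms by (simp add: M.l_neg M.minus_equality)

text \<open>A closure in place of linear combinations, so that arguments about generators become
  rule inductions. With a field for \<open>R\<close> it is the linear span of the dimension
  arguments.\<close>

inductive_set mod_span ::
    "('a, 'e) ring_scheme \<Rightarrow> ('a, 'm, 'f) module_scheme \<Rightarrow> 'm set \<Rightarrow> 'm set"
  for R :: "('a, 'e) ring_scheme" and M :: "('a, 'm, 'f) module_scheme" and S :: "'m set" where
  zero: "\<zero>\<^bsub>M\<^esub> \<in> mod_span R M S"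
| base: "s \<in> S \<Longrightarrow> s \<in> mod_span R M S"
| add: "\<lbrakk>x \<in> mod_span R M S; y \<in> mod_span R M S\<rbrakk> \<Longrightarrow> x \<oplus>\<^bsub>M\<^esub> y \<in> mod_span R M S"
| smult: "\<lbrakk>a \<in> carrier R; x \<in> mod_span R M S\<rbrakk> \<Longrightarrow> a \<odot>\<^bsub>M\<^esub> x \<in> mod_span R M S"

lemma (in left_module) mod_span_closed: "S \<subseteq> carrier M \<Longrightarrow> mod_span R M S \<subseteq> carrier M"
proof
  fix x assume S: "S \<subseteq> carrier M" and "x \<in> mod_span R M S"
  from this(2) show "x \<in> carrier M" by induction (use S in auto)
qed

lemma mod_span_least:
  assumes "S \<subseteq> mod_span R M T"
  shows "mod_span R M S \<subseteq> mod_span R M T"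
proof
  fix x assume "x \<in> mod_span R M S"
  then show "x \<in> mod_span R M T" by induction (use assms in \<open>auto intro: mod_span.intros\<close>)
qed

lemma mod_span_mono: "S \<subseteq> T \<Longrightarrow> mod_span R M S \<subseteq> mod_span R M T"
  by (rule mod_span_least) (auto intro: mod_span.base)

lemma (in left_module) mod_span_finsum:
  assumes "finite F" "F \<subseteq> carrier M" "c \<in> F \<rightarrow> carrier R"
  shows "(\<Oplus>\<^bsub>M\<^esub>s\<in>F. c s \<odot>\<^bsub>M\<^esub> s) \<in> mod_span R M F"
  using assms
proof (induction F)
  case (insert s F)
  have "(\<Oplus>\<^bsub>M\<^esub>t\<in>insert s F. c t \<odot>\<^bsub>M\<^esub> t) = c s \<odot>\<^bsub>M\<^esub> s \<oplus>\<^bsub>M\<^esub> (\<Oplus>\<^bsub>M\<^esub>t\<in>F. c t \<odot>\<^bsub>M\<^esub> t)"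
    using insert by (intro M.finsum_insert) (auto simp: Pi_iff)
  moreover have "(\<Oplus>\<^bsub>M\<^esub>t\<in>F. c t \<odot>\<^bsub>M\<^esub> t) \<in> mod_span R M (insert s F)"
    using insert mod_span_mono[of F "insert s F" R M] by auto
  ultimately show ?case using insert by (auto intro: mod_span.intros)
qed (simp add: mod_span.zero)

text \<open>Isolating the coefficient of one generator is what drives the inductions over finite
  generating sets.\<close>

lemma (in left_module) mod_span_insert:
  assumes "s \<in> carrier M" "S \<subseteq> carrier M" "x \<in> mod_span R M (insert s S)"
  shows "\<exists>a\<in>carrier R. \<exists>y\<in>mod_span R M S. x = a \<odot>\<^bsub>M\<^esub> s \<oplus>\<^bsub>M\<^esub> y"
  using assms(3)
proof induction
  case zero
  show ?case
    by (intro bexI[of _ \<zero>] bexI[of _ "\<zero>\<^bsub>M\<^esub>"]) (use assms in \<open>auto intro: mod_span.zero\<close>)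
next
  case (base t)
  show ?case
  proof (cases "t = s")
    case True
    then show ?thesis
      by (intro bexI[of _ \<one>] bexI[of _ "\<zero>\<^bsub>M\<^esub>"]) (use assms in \<open>auto intro: mod_span.zero\<close>)
  next
    case False
    then have "t \<in> S" using base by auto
    then show ?thesis
      by (intro bexI[of _ \<zero>] bexI[of _ t]) (use assms in \<open>auto intro: mod_span.base\<close>)
  qed
next
  case (add x y)
  then obtain a x' b y' where *: "a \<in> carrier R" "x' \<in> mod_span R M S" "x = a \<odot>\<^bsub>M\<^esub> s \<oplus>\<^bsub>M\<^esub> x'"
    "b \<in> carrier R" "y' \<in> mod_span R M S" "y = b \<odot>\<^bsub>M\<^esub> s \<oplus>\<^bsub>M\<^esub> y'" by blast
  moreover have "x' \<in> carrier M" "y' \<in> carrier M" using * mod_span_closed assms by auto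
  ultimately have "x \<oplus>\<^bsub>M\<^esub> y = (a \<oplus> b) \<odot>\<^bsub>M\<^esub> s \<oplus>\<^bsub>M\<^esub> (x' \<oplus>\<^bsub>M\<^esub> y')"
    using assms by (simp add: smult_l_distr M.a_ac)
  then show ?case using * by (metis R.add.m_closed mod_span.add)
next
  case (smult b x)
  then obtain a x' where *: "a \<in> carrier R" "x' \<in> mod_span R M S" "x = a \<odot>\<^bsub>M\<^esub> s \<oplus>\<^bsub>M\<^esub> x'" by blast
  moreover have "x' \<in> carrier M" using * mod_span_closed assms by auto
  ultimately have "b \<odot>\<^bsub>M\<^esub> x = (b \<otimes> a) \<odot>\<^bsub>M\<^esub> s \<oplus>\<^bsub>M\<^esub> b \<odot>\<^bsub>M\<^esub> x'"
    using smult assms by (simp add: smult_r_distr smult_assoc)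
  then show ?case using * smult by (metis R.m_closed mod_span.smult)
qed

lemma (in left_module) mod_span_imp_finsum:
  assumes "finite F" "F \<subseteq> carrier M" "x \<in> mod_span R M F"
  shows "\<exists>c \<in> F \<rightarrow> carrier R. x = (\<Oplus>\<^bsub>M\<^esub>s\<in>F. c s \<odot>\<^bsub>M\<^esub> s)"
  using assms
proof (induction F arbitrary: x)
  case empty
  have "x = \<zero>\<^bsub>M\<^esub>" using empty(2) by induction auto
  then show ?case by simp
next
  case (insert s F)
  from mod_span_insert[of s F x] insert obtain a y where
    y: "a \<in> carrier R" "y \<in> mod_span R M F" "x = a \<odot>\<^bsub>M\<^esub> s \<oplus>\<^bsub>M\<^esub> y" by auto
  with insert obtain c where c: "c \<in> F \<rightarrow> carrier R" "y = (\<Oplus>\<^bsub>M\<^esub>s\<in>F. c s \<odot>\<^bsub>M\<^esub> s)" by blast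
  \<comment> \<open>Since \<open>s\<close> is not in \<open>F\<close>, changing the coefficient at
    \<open>s\<close> leaves the sum over \<open>F\<close> alone.\<close>
  define c' where "c' = c(s := a)"
  have c': "c' \<in> insert s F \<rightarrow> carrier R" using c y by (auto simp: c'_def)
  have "(\<Oplus>\<^bsub>M\<^esub>t\<in>insert s F. c' t \<odot>\<^bsub>M\<^esub> t) = c' s \<odot>\<^bsub>M\<^esub> s \<oplus>\<^bsub>M\<^esub> (\<Oplus>\<^bsub>M\<^esub>t\<in>F. c' t \<odot>\<^bsub>M\<^esub> t)"
    using insert c' by (intro M.finsum_insert) (auto simp: Pi_iff)
  also have "(\<Oplus>\<^bsub>M\<^esub>t\<in>F. c' t \<odot>\<^bsub>M\<^esub> t) = y"
    unfolding c(2) by (rule M.finsum_cong') (use insert c in \<open>auto simp: c'_def Pi_iff\<close>)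
  finally have "x = (\<Oplus>\<^bsub>M\<^esub>t\<in>insert s F. c' t \<odot>\<^bsub>M\<^esub> t)" using y by (simp add: c'_def)
  with c' show ?case by blast
qed

lemma (in left_module) finitely_generated_iff_span:
  "finitely_generated R M \<longleftrightarrow> (\<exists>S. finite S \<and> S \<subseteq> carrier M \<and> mod_span R M S = carrier M)"
proof
  assume "finitely_generated R M"
  then obtain S where S: "finite S" "S \<subseteq> carrier M"
    "\<forall>x\<in>carrier M. \<exists>c \<in> S \<rightarrow> carrier R. x = (\<Oplus>\<^bsub>M\<^esub>s\<in>S. c s \<odot>\<^bsub>M\<^esub> s)"
    by (auto simp: finitely_generated_def)
  have "carrier M \<subseteq> mod_span R M S"
  proof
    fix x assume "x \<in> carrier M"
    with S(3) obtain c where "c \<in> S \<rightarrow> carrier R" "x = (\<Oplus>\<^bsub>M\<^esub>s\<in>S. c s \<odot>\<^bsub>M\<^esub> s)" by auto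
    then show "x \<in> mod_span R M S" using mod_span_finsum[OF S(1,2)] by simp
  qed
  then show "\<exists>S. finite S \<and> S \<subseteq> carrier M \<and> mod_span R M S = carrier M"
    using S(1,2) mod_span_closed[OF S(2)] by blast
next
  assume "\<exists>S. finite S \<and> S \<subseteq> carrier M \<and> mod_span R M S = carrier M"
  then obtain S where S: "finite S" "S \<subseteq> carrier M" "mod_span R M S = carrier M" by blast
  then show "finitely_generated R M"
    unfolding finitely_generated_def using mod_span_imp_finsum[OF S(1,2)] by blast
qed


section \<open>Homomorphisms, images and quotients\<close>

lemma mod_hom_closed: "\<lbrakk>f \<in> mod_hom R M N; x \<in> carrier M\<rbrakk> \<Longrightarrow> f x \<in> carrier N"
  by (auto simp: mod_hom_def)

lemma mod_hom_add:
  "\<lbrakk>f \<in> mod_hom R M N; x \<in> carrier M; y \<in> carrier M\<rbrakk> \<Longrightarrow> f (x \<oplus>\<^bsub>M\<^esub> y) = f x \<oplus>\<^bsub>N\<^esub> f y"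
  by (auto simp: mod_hom_def)

lemma mod_hom_smult:
  "\<lbrakk>f \<in> mod_hom R M N; a \<in> carrier R; x \<in> carrier M\<rbrakk> \<Longrightarrow> f (a \<odot>\<^bsub>M\<^esub> x) = a \<odot>\<^bsub>N\<^esub> f x"
  by (auto simp: mod_hom_def)

lemma mod_hom_restrictI:
  assumes "\<And>x. x \<in> carrier M \<Longrightarrow> f x \<in> carrier N"
    "\<And>x y. \<lbrakk>x \<in> carrier M; y \<in> carrier M\<rbrakk> \<Longrightarrow> f (x \<oplus>\<^bsub>M\<^esub> y) = f x \<oplus>\<^bsub>N\<^esub> f y"
    "\<And>a x. \<lbrakk>a \<in> carrier R; x \<in> carrier M\<rbrakk> \<Longrightarrow> f (a \<odot>\<^bsub>M\<^esub> x) = a \<odot>\<^bsub>N\<^esub> f x"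
    and "left_module R M"
  shows "restrict f (carrier M) \<in> mod_hom R M N"
proof -
  interpret left_module R M by fact
  show ?thesis using assms(1-3) by (simp add: mod_hom_def)
qed

lemma mod_hom_zero:
  assumes "left_module R M" "left_module R N" "f \<in> mod_hom R M N"
  shows "f \<zero>\<^bsub>M\<^esub> = \<zero>\<^bsub>N\<^esub>"
proof -
  interpret M: left_module R M by fact
  interpret N: left_module R N by fact
  show ?thesis
    using mod_hom_smult[OF assms(3), of "\<zero>\<^bsub>R\<^esub>" "\<zero>\<^bsub>M\<^esub>"] mod_hom_closed[OF assms(3)] by simp
qed

lemma mod_hom_minus:
  assumes "left_module R M" "left_module R N" "f \<in> mod_hom R M N" "x \<in> carrier M"
  shows "f (\<ominus>\<^bsub>M\<^esub> x) = \<ominus>\<^bsub>N\<^esub> f x"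
proof -
  interpret M: left_module R M by fact
  interpret N: left_module R N by fact
  show ?thesis
    using mod_hom_smult[OF assms(3), of "\<ominus>\<^bsub>R\<^esub> \<one>\<^bsub>R\<^esub>" x] mod_hom_closed[OF assms(3)] assms(4)
    by (simp add: M.smult_minus_one N.smult_minus_one)
qed

lemma mod_hom_inj_iff:
  assumes "left_module R M" "left_module R N" "f \<in> mod_hom R M N"
  shows "inj_on f (carrier M) \<longleftrightarrow> (\<forall>x\<in>carrier M. f x = \<zero>\<^bsub>N\<^esub> \<longrightarrow> x = \<zero>\<^bsub>M\<^esub>)"
proof
  interpret M: left_module R M by fact
  interpret N: left_module R N by fact
  show "inj_on f (carrier M) \<Longrightarrow> \<forall>x\<in>carrier M. f x = \<zero>\<^bsub>N\<^esub> \<longrightarrow> x = \<zero>\<^bsub>M\<^esub>"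
    using mod_hom_zero[OF assms] by (metis M.zero_closed inj_onD)
  assume *: "\<forall>x\<in>carrier M. f x = \<zero>\<^bsub>N\<^esub> \<longrightarrow> x = \<zero>\<^bsub>M\<^esub>"
  show "inj_on f (carrier M)"
  proof (rule inj_onI)
    fix x y assume xy: "x \<in> carrier M" "y \<in> carrier M" "f x = f y"
    have "f (x \<ominus>\<^bsub>M\<^esub> y) = \<zero>\<^bsub>N\<^esub>"
      using xy mod_hom_closed[OF assms(3)] mod_hom_minus[OF assms]
      by (simp add: M.minus_eq mod_hom_add[OF assms(3)] N.r_neg)
    then have "x \<oplus>\<^bsub>M\<^esub> \<ominus>\<^bsub>M\<^esub> y = \<zero>\<^bsub>M\<^esub>" using * xy by (simp add: M.minus_eq)
    then show "x = y" using M.minus_equality[of x "\<ominus>\<^bsub>M\<^esub> y"] xy by simp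
  qed
qed

lemma mod_hom_compose:
  assumes "left_module R M" "f \<in> mod_hom R M N" "g \<in> mod_hom R N P"
  shows "compose (carrier M) g f \<in> mod_hom R M P"
  unfolding compose_def
  by (rule mod_hom_restrictI)
     (use assms in \<open>simp_all add: mod_hom_closed mod_hom_add mod_hom_smult\<close>)

text \<open>Each axiom is transported along \<open>p\<close>, which is how images and quotients are
  recognised as modules. Preservation of zero is a hypothesis because \<open>mod_hom_zero\<close>
  already needs a module as codomain.\<close>

lemma left_module_surj:
  assumes "left_module R M" "p \<in> mod_hom R M N" "p ` carrier M = carrier N" "p \<zero>\<^bsub>M\<^esub> = \<zero>\<^bsub>N\<^esub>"
  shows "left_module R N"
proof -
  interpret left_module R M by fact
  note [simp] = mod_hom_add[OF assms(2), symmetric] mod_hom_smult[OF assms(2), symmetric]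
    assms(3)[symmetric] assms(4)[symmetric]
  have grp: "abelian_group N"
  proof (rule abelian_groupI)
    fix u assume "u \<in> carrier N"
    then obtain x where x: "x \<in> carrier M" "u = p x" by auto
    then have "p (\<ominus>\<^bsub>M\<^esub> x) \<oplus>\<^bsub>N\<^esub> u = \<zero>\<^bsub>N\<^esub>" by (simp add: M.l_neg)
    then show "\<exists>v\<in>carrier N. v \<oplus>\<^bsub>N\<^esub> u = \<zero>\<^bsub>N\<^esub>" using x by force
  qed (auto simp: M.a_ac)
  show ?thesis
    by (intro left_module.intro left_module_axioms.intro grp R.ring_axioms)
       (auto simp: smult_l_distr smult_r_distr smult_assoc)
qed

lemma mod_hom_image_span:
  assumes "left_module R M" "p \<in> mod_hom R M N" "p \<zero>\<^bsub>M\<^esub> = \<zero>\<^bsub>N\<^esub>" "S \<subseteq> carrier M"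
  shows "p ` mod_span R M S = mod_span R N (p ` S)"
proof safe
  interpret left_module R M by fact
  note Sc = subsetD[OF mod_span_closed[OF assms(4)]]
  show "p x \<in> mod_span R N (p ` S)" if "x \<in> mod_span R M S" for x
    using that
  proof induction
    case (add x y)
    then show ?case using Sc by (simp add: mod_hom_add[OF assms(2)] mod_span.add)
  next
    case (smult a x)
    then show ?case using Sc by (simp add: mod_hom_smult[OF assms(2)] mod_span.smult)
  qed (auto simp: assms(3) intro: mod_span.zero mod_span.base)
  show "y \<in> p ` mod_span R M S" if "y \<in> mod_span R N (p ` S)" for y
    using that
  proof induction
    case zero
    show ?case using assms(3) mod_span.zero by (metis imageI)
  next
    case (base y)
    then show ?case by (auto intro: mod_span.base)
  next
    case (add x y)
    then obtain u v where "u \<in> mod_span R M S" "v \<in> mod_span R M S" "x = p u" "y = p v" by blast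
    then show ?case
      using Sc mod_span.add by (intro image_eqI[of _ _ "u \<oplus>\<^bsub>M\<^esub> v"]) (auto simp: mod_hom_add[OF assms(2)])
  next
    case (smult a x)
    then obtain u where "u \<in> mod_span R M S" "x = p u" by blast
    then show ?case
      using Sc smult mod_span.smult
      by (intro image_eqI[of _ _ "a \<odot>\<^bsub>M\<^esub> u"]) (auto simp: mod_hom_smult[OF assms(2)])
  qed
qed

lemma surj_span:
  assumes "left_module R M" "p \<in> mod_hom R M N" "p ` carrier M = carrier N" "p \<zero>\<^bsub>M\<^esub> = \<zero>\<^bsub>N\<^esub>"
    "S \<subseteq> carrier M" "mod_span R M S = carrier M"
  shows "mod_span R N (p ` S) = carrier N"
  using mod_hom_image_span[OF assms(1,2,4,5)] assms(3,6) by simp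

lemma mod_cat_left_module: "M \<in> mod_cat R \<Longrightarrow> left_module R M"
  by (simp add: mod_cat_def)

lemma mod_cat_surj:
  assumes "M \<in> mod_cat R" "p \<in> mod_hom R M N" "p ` carrier M = carrier N" "p \<zero>\<^bsub>M\<^esub> = \<zero>\<^bsub>N\<^esub>"
  shows "N \<in> mod_cat R"
proof -
  note M = mod_cat_left_module[OF assms(1)]
  interpret M: left_module R M by fact
  interpret N: left_module R N by (rule left_module_surj[OF M assms(2-4)])
  obtain S where S: "finite S" "S \<subseteq> carrier M" "mod_span R M S = carrier M"
    using assms(1) M.finitely_generated_iff_span by (auto simp: mod_cat_def)
  have "finite (p ` S)" "p ` S \<subseteq> carrier N" "mod_span R N (p ` S) = carrier N"
    using S assms surj_span[OF M assms(2-4) S(2,3)] by auto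
  then have "finitely_generated R N" unfolding N.finitely_generated_iff_span by blast
  then show ?thesis by (simp add: mod_cat_def N.left_module_axioms)
qed

text \<open>As a quotient of \<open>M\<close>, the image inherits finite generation from
  \<open>M\<close>, without any noetherian argument about submodules of \<open>N\<close>. The two
  homomorphisms factor \<open>f\<close> as a surjection followed by the inclusion.\<close>

lemma mod_cat_image:
  assumes "M \<in> mod_cat R" "N \<in> mod_cat R" "f \<in> mod_hom R M N"
  obtains I where "I \<in> mod_cat R" "carrier I = f ` carrier M" "\<zero>\<^bsub>I\<^esub> = \<zero>\<^bsub>N\<^esub>"
    "f \<in> mod_hom R M I" "(\<lambda>x\<in>carrier I. x) \<in> mod_hom R I N"
proof -
  define I where "I = N\<lparr>carrier := f ` carrier M\<rparr>"
  have f: "f \<in> mod_hom R M I" using assms(3) by (auto simp: I_def mod_hom_def PiE_iff)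
  have I: "I \<in> mod_cat R"
    using mod_hom_zero[OF mod_cat_left_module[OF assms(1)] mod_cat_left_module[OF assms(2)] assms(3)]
    by (intro mod_cat_surj[OF assms(1) f]) (auto simp: I_def)
  moreover have "(\<lambda>x\<in>carrier I. x) \<in> mod_hom R I N"
    using mod_cat_left_module[OF I] mod_hom_closed[OF assms(3)]
    by (intro mod_hom_restrictI) (auto simp: I_def)
  ultimately show thesis using f by (intro that[of I]) (auto simp: I_def)
qed

text \<open>The cokernel of \<open>i\<close>, built from congruence modulo the image of
  \<open>i\<close>. The description of the kernel of \<open>p\<close> is what the extension
  arguments need.\<close>

lemma mod_cat_quotient:
  assumes "M \<in> mod_cat R" "I \<in> mod_cat R" "i \<in> mod_hom R I M"
  obtains Q p where "Q \<in> mod_cat R" "p \<in> mod_hom R M Q" "p ` carrier M = carrier Q"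
    "\<And>x. x \<in> carrier M \<Longrightarrow> p x = \<zero>\<^bsub>Q\<^esub> \<longleftrightarrow> x \<in> i ` carrier I"
proof -
  note lm = mod_cat_left_module[OF assms(1)] mod_cat_left_module[OF assms(2)]
  interpret M: left_module R M by (rule lm)
  interpret I: left_module R I by (rule lm)
  define J where "J = i ` carrier I"
  note ic = mod_hom_closed[OF assms(3)]
  have JM: "x \<in> carrier M" if "x \<in> J" for x using that ic by (auto simp: J_def)
  have J0: "\<zero>\<^bsub>M\<^esub> \<in> J" using mod_hom_zero[OF lm(2,1) assms(3)] by (force simp: J_def)
  have Ja: "x \<oplus>\<^bsub>M\<^esub> y \<in> J" if "x \<in> J" "y \<in> J" for x y
    using that by (auto simp: J_def mod_hom_add[OF assms(3), symmetric])
  have Js: "a \<odot>\<^bsub>M\<^esub> x \<in> J" if "x \<in> J" "a \<in> carrier R" for a x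
    using that by (auto simp: J_def mod_hom_smult[OF assms(3), symmetric])
  have Jm: "\<ominus>\<^bsub>M\<^esub> x \<in> J" if "x \<in> J" for x
    using Js[OF that, of "\<ominus>\<^bsub>R\<^esub> \<one>\<^bsub>R\<^esub>"] JM[OF that] by (simp add: M.smult_minus_one)
  define rel where "rel x y \<longleftrightarrow> x \<in> carrier M \<and> y \<in> carrier M \<and> x \<ominus>\<^bsub>M\<^esub> y \<in> J" for x y
  have rel_refl: "rel x x" if "x \<in> carrier M" for x
    using that J0 by (simp add: rel_def M.minus_eq M.r_neg)
  have rel_sym: "rel y x" if "rel x y" for x y
  proof -
    have "\<ominus>\<^bsub>M\<^esub> (x \<ominus>\<^bsub>M\<^esub> y) = y \<ominus>\<^bsub>M\<^esub> x"
      using that by (simp add: rel_def M.minus_eq M.minus_add M.a_ac)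
    then show ?thesis using that Jm by (metis rel_def)
  qed
  have rel_trans: "rel x z" if "rel x y" "rel y z" for x y z
  proof -
    have "(x \<ominus>\<^bsub>M\<^esub> y) \<oplus>\<^bsub>M\<^esub> (y \<ominus>\<^bsub>M\<^esub> z) = x \<ominus>\<^bsub>M\<^esub> z"
      using that by (simp add: rel_def M.minus_eq M.a_assoc M.r_neg1)
    then show ?thesis using that Ja by (metis rel_def)
  qed
  have rel_add: "rel (x \<oplus>\<^bsub>M\<^esub> y) (x' \<oplus>\<^bsub>M\<^esub> y')" if "rel x x'" "rel y y'" for x x' y y'
  proof -
    have "(x \<ominus>\<^bsub>M\<^esub> x') \<oplus>\<^bsub>M\<^esub> (y \<ominus>\<^bsub>M\<^esub> y') = (x \<oplus>\<^bsub>M\<^esub> y) \<ominus>\<^bsub>M\<^esub> (x' \<oplus>\<^bsub>M\<^esub> y')"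
      using that by (simp add: rel_def M.minus_eq M.minus_add M.a_ac)
    then show ?thesis using that Ja by (metis rel_def M.add.m_closed)
  qed
  have rel_smult: "rel (a \<odot>\<^bsub>M\<^esub> x) (a \<odot>\<^bsub>M\<^esub> y)" if "rel x y" "a \<in> carrier R" for a x y
  proof -
    have "a \<odot>\<^bsub>M\<^esub> x \<ominus>\<^bsub>M\<^esub> a \<odot>\<^bsub>M\<^esub> y = a \<odot>\<^bsub>M\<^esub> (x \<ominus>\<^bsub>M\<^esub> y)"
      using that by (simp add: rel_def M.minus_eq M.smult_r_distr M.smult_minus)
    then show ?thesis using that Js by (simp add: rel_def)
  qed
  \<comment> \<open>Cosets are replaced by chosen representatives, so that the quotient lives over the same type.\<close>
  define r where "r x = (SOME y. rel x y)" for x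
  have r: "rel x (r x)" if "x \<in> carrier M" for x
    using someI[of "rel x", OF rel_refl[OF that]] by (simp add: r_def)
  have r_eq: "r x = r y" if "rel x y" for x y
  proof -
    \<comment> \<open>Congruent elements define the same predicate, so the choice operator returns
      the same representative for both.\<close>
    have "rel x = rel y" by (intro ext iffI) (metis that rel_sym rel_trans)+
    then show ?thesis by (simp add: r_def)
  qed
  have r_rel: "rel x y" if "r x = r y" "x \<in> carrier M" "y \<in> carrier M" for x y
    using that r rel_sym rel_trans by metis
  define Q :: "('a, 'a list) module" where
    "Q = \<lparr>carrier = r ` carrier M, monoid.mult = undefined, monoid.one = undefined,
          ring.zero = r \<zero>\<^bsub>M\<^esub>, ring.add = (\<lambda>u v. r (u \<oplus>\<^bsub>M\<^esub> v)), smult = (\<lambda>a u. r (a \<odot>\<^bsub>M\<^esub> u))\<rparr>"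
  define p where "p = restrict r (carrier M)"
  \<comment> \<open>Linearity amounts to the operations of \<open>Q\<close> being independent of
    representatives: replacing elements by their representatives changes a sum or a multiple only
    within its class.\<close>
  have p: "p \<in> mod_hom R M Q"
    unfolding p_def
    by (rule mod_hom_restrictI) (auto simp: Q_def lm intro!: r_eq rel_add rel_smult r)
  have s: "p ` carrier M = carrier Q" by (simp add: p_def Q_def)
  have "Q \<in> mod_cat R" by (rule mod_cat_surj[OF assms(1) p s]) (simp add: p_def Q_def)
  moreover have "p x = \<zero>\<^bsub>Q\<^esub> \<longleftrightarrow> x \<in> i ` carrier I" if "x \<in> carrier M" for x
  proof -
    have "p x = \<zero>\<^bsub>Q\<^esub> \<longleftrightarrow> rel x \<zero>\<^bsub>M\<^esub>"
      using that r_eq[of x "\<zero>\<^bsub>M\<^esub>"] r_rel[of x "\<zero>\<^bsub>M\<^esub>"] by (auto simp: p_def Q_def)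
    moreover have "\<ominus>\<^bsub>M\<^esub> \<zero>\<^bsub>M\<^esub> = \<zero>\<^bsub>M\<^esub>" using M.r_neg[of "\<zero>\<^bsub>M\<^esub>"] by simp
    ultimately show ?thesis using that by (simp add: rel_def M.minus_eq J_def)
  qed
  ultimately show thesis using p s by (intro that)
qed


section \<open>Orthogonal classes\<close>

lemma is_zero_hom_iff:
  "f \<in> mod_hom R M N \<Longrightarrow> is_zero_hom M N f \<longleftrightarrow> (\<forall>x\<in>carrier M. f x = \<zero>\<^bsub>N\<^esub>)"
  by (auto simp: is_zero_hom_def mod_hom_def PiE_iff extensional_def fun_eq_iff)

lemma hom_zeroI:
  "(\<And>f x. \<lbrakk>f \<in> mod_hom R M N; x \<in> carrier M\<rbrakk> \<Longrightarrow> f x = \<zero>\<^bsub>N\<^esub>) \<Longrightarrow> hom_zero R M N"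
  by (simp add: is_zero_hom_iff)

lemma hom_zeroD: "\<lbrakk>hom_zero R M N; f \<in> mod_hom R M N; x \<in> carrier M\<rbrakk> \<Longrightarrow> f x = \<zero>\<^bsub>N\<^esub>"
  using is_zero_hom_iff by blast

lemma not_hom_zeroE:
  assumes "\<not> hom_zero R M N"
  obtains f x where "f \<in> mod_hom R M N" "x \<in> carrier M" "f x \<noteq> \<zero>\<^bsub>N\<^esub>"
  using assms hom_zeroI by metis

text \<open>Test the vanishing on the identity. It serves to show that a module lying both in a
  class and in its perp is zero.\<close>

lemma hom_zero_self:
  assumes "left_module R M" "hom_zero R M M" "x \<in> carrier M"
  shows "x = \<zero>\<^bsub>M\<^esub>"
  using hom_zeroD[OF assms(2) mod_hom_restrictI[OF _ _ _ assms(1), of "\<lambda>x. x"] assms(3)] assms(3)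
  by simp

lemma left_perp_subset: "left_perp R \<V> \<subseteq> mod_cat R"
  and right_perp_subset: "right_perp R \<U> \<subseteq> mod_cat R"
  by (auto simp: left_perp_def right_perp_def)

lemma left_perp_zero:
  assumes "M \<in> mod_cat R" "carrier M = {\<zero>\<^bsub>M\<^esub>}" "\<V> \<subseteq> mod_cat R"
  shows "M \<in> left_perp R \<V>"
proof -
  have "hom_zero R M N" if "N \<in> \<V>" for N
  proof (rule hom_zeroI)
    fix f x assume "f \<in> mod_hom R M N" "x \<in> carrier M"
    then show "f x = \<zero>\<^bsub>N\<^esub>"
      using mod_hom_zero[of R M N f] assms that by (auto simp: mod_cat_def)
  qed
  then show ?thesis using assms(1) by (auto simp: left_perp_def)
qed

text \<open>A map out of \<open>Y\<close> is determined by its composite with the surjection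
  \<open>p\<close>, and that composite vanishes.\<close>

lemma left_perp_quotient:
  assumes "L \<in> left_perp R \<V>" "Y \<in> mod_cat R" "p \<in> mod_hom R L Y" "p ` carrier L = carrier Y"
  shows "Y \<in> left_perp R \<V>"
proof -
  have "hom_zero R Y N" if "N \<in> \<V>" for N
  proof (rule hom_zeroI)
    fix f y assume f: "f \<in> mod_hom R Y N" and "y \<in> carrier Y"
    then obtain x where x: "x \<in> carrier L" "y = p x" using assms by auto
    have "left_module R L" "hom_zero R L N"
      using assms(1) that by (auto simp: left_perp_def mod_cat_def)
    then have "compose (carrier L) f p x = \<zero>\<^bsub>N\<^esub>"
      using mod_hom_compose[OF _ assms(3) f] x(1) by (blast intro: hom_zeroD)
    then show "f y = \<zero>\<^bsub>N\<^esub>" using x by (simp add: compose_def)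
  qed
  then show ?thesis using assms by (auto simp: left_perp_def)
qed

lemma right_perp_submodule:
  assumes "Y \<in> right_perp R \<U>" "L \<in> mod_cat R" "i \<in> mod_hom R L Y" "inj_on i (carrier L)"
    "\<U> \<subseteq> mod_cat R"
  shows "L \<in> right_perp R \<U>"
proof -
  have "hom_zero R N L" if "N \<in> \<U>" for N
  proof (rule hom_zeroI)
    fix f x assume f: "f \<in> mod_hom R N L" and x: "x \<in> carrier N"
    have N: "left_module R N" "hom_zero R N Y" and XY: "left_module R L" "left_module R Y"
      using assms(1,2,5) that by (auto simp: right_perp_def mod_cat_def)
    have "compose (carrier N) i f x = \<zero>\<^bsub>Y\<^esub>"
      by (rule hom_zeroD[OF N(2) mod_hom_compose[OF N(1) f assms(3)] x])
    then have "i (f x) = \<zero>\<^bsub>Y\<^esub>" using x by (simp add: compose_def)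
    then show "f x = \<zero>\<^bsub>L\<^esub>"
      using assms(4) mod_hom_inj_iff[OF XY assms(3)] mod_hom_closed[OF f x] by blast
  qed
  then show ?thesis using assms by (auto simp: right_perp_def)
qed

text \<open>A map from \<open>L\<close> to a module of \<open>\<V>\<close> kills the image of
  \<open>I\<close>, hence the kernel of \<open>p\<close>, so it factors through \<open>Y\<close>,
  where it vanishes too. The kernel condition is an inclusion in the image of \<open>i\<close>, so
  \<open>i\<close> may be any map from a module of the class; later it is a given nonzero map into a
  brick.\<close>

lemma left_perp_extension:
  assumes "L \<in> mod_cat R" "I \<in> left_perp R \<V>" "Y \<in> left_perp R \<V>" "i \<in> mod_hom R I L"
    "p \<in> mod_hom R L Y" "p ` carrier L = carrier Y"
    "\<And>x. x \<in> carrier L \<Longrightarrow> p x = \<zero>\<^bsub>Y\<^esub> \<Longrightarrow> x \<in> i ` carrier I"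
    "\<V> \<subseteq> mod_cat R"
  shows "L \<in> left_perp R \<V>"
proof -
  have lm: "left_module R L" "left_module R I" "left_module R Y"
    using assms(1-3) by (auto simp: left_perp_def mod_cat_def)
  interpret L: left_module R L by (rule lm)
  interpret Y: left_module R Y by (rule lm)
  have "hom_zero R L N" if "N \<in> \<V>" for N
  proof (rule hom_zeroI)
    fix f x assume f: "f \<in> mod_hom R L N" and x: "x \<in> carrier L"
    have N: "left_module R N" using assms(8) that by (auto simp: mod_cat_def)
    interpret N: left_module R N by (rule N)
    note fc = mod_hom_closed[OF f]
    have f_ker: "f u = \<zero>\<^bsub>N\<^esub>" if u: "u \<in> carrier L" "p u = \<zero>\<^bsub>Y\<^esub>" for u
    proof -
      obtain v where v: "v \<in> carrier I" "u = i v" using assms(7)[OF u] by auto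
      have "hom_zero R I N" using assms(2) \<open>N \<in> \<V>\<close> by (simp add: left_perp_def)
      from hom_zeroD[OF this mod_hom_compose[OF lm(2) assms(4) f] v(1)] v
      show ?thesis by (simp add: compose_def)
    qed
    have f_eq: "f u = f v" if uv: "u \<in> carrier L" "v \<in> carrier L" "p u = p v" for u v
    proof -
      have "p (u \<ominus>\<^bsub>L\<^esub> v) = \<zero>\<^bsub>Y\<^esub>"
        using uv mod_hom_closed[OF assms(5)] mod_hom_minus[OF lm(1,3) assms(5)]
        by (simp add: L.minus_eq mod_hom_add[OF assms(5)] Y.r_neg)
      then have "f (u \<ominus>\<^bsub>L\<^esub> v) = \<zero>\<^bsub>N\<^esub>" using uv by (intro f_ker) auto
      then have "f u \<oplus>\<^bsub>N\<^esub> \<ominus>\<^bsub>N\<^esub> f v = \<zero>\<^bsub>N\<^esub>"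
        using uv mod_hom_minus[OF lm(1) N f] by (simp add: L.minus_eq mod_hom_add[OF f])
      then show ?thesis using N.minus_equality[of "f u" "\<ominus>\<^bsub>N\<^esub> f v"] uv fc by simp
    qed
    \<comment> \<open>A set-theoretic section of \<open>p\<close>. By \<open>f_eq\<close>, the
      composite of \<open>f\<close> with \<open>s\<close> does not depend on the choice, so it is
      the linear map induced by \<open>f\<close> on \<open>Y\<close>.\<close>
    define s where "s y = (SOME u. u \<in> carrier L \<and> p u = y)" for y
    have s: "s y \<in> carrier L" "p (s y) = y" if "y \<in> carrier Y" for y
    proof -
      have "\<exists>u. u \<in> carrier L \<and> p u = y" using that assms(6) by (metis imageE)
      from someI_ex[OF this] show "s y \<in> carrier L" "p (s y) = y" by (simp_all add: s_def)
    qed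
    have "(\<lambda>y\<in>carrier Y. f (s y)) \<in> mod_hom R Y N"
    proof (rule mod_hom_restrictI[OF _ _ _ lm(3)])
      fix y z assume yz: "y \<in> carrier Y" "z \<in> carrier Y"
      then have "f (s (y \<oplus>\<^bsub>Y\<^esub> z)) = f (s y \<oplus>\<^bsub>L\<^esub> s z)"
        by (intro f_eq) (simp_all add: s mod_hom_add[OF assms(5)])
      then show "f (s (y \<oplus>\<^bsub>Y\<^esub> z)) = f (s y) \<oplus>\<^bsub>N\<^esub> f (s z)" using yz s by (simp add: mod_hom_add[OF f])
    next
      fix a y assume ay: "a \<in> carrier R" "y \<in> carrier Y"
      then have "f (s (a \<odot>\<^bsub>Y\<^esub> y)) = f (a \<odot>\<^bsub>L\<^esub> s y)"
        by (intro f_eq) (simp_all add: s mod_hom_smult[OF assms(5)])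
      then show "f (s (a \<odot>\<^bsub>Y\<^esub> y)) = a \<odot>\<^bsub>N\<^esub> f (s y)" using ay s by (simp add: mod_hom_smult[OF f])
    qed (simp add: s fc)
    moreover have "hom_zero R Y N" using assms(3) that by (simp add: left_perp_def)
    ultimately have "(\<lambda>y\<in>carrier Y. f (s y)) (p x) = \<zero>\<^bsub>N\<^esub>"
      using mod_hom_closed[OF assms(5) x] by (blast intro: hom_zeroD)
    moreover have "f x = f (s (p x))"
      using x s mod_hom_closed[OF assms(5) x] by (intro f_eq) auto
    ultimately show "f x = \<zero>\<^bsub>N\<^esub>" using mod_hom_closed[OF assms(5) x] by simp
  qed
  then show ?thesis using assms by (auto simp: left_perp_def)
qed


section \<open>Torsion classes\<close>

lemma torsion_class_double_perp:
  "\<T> \<in> torsion_classes R \<Longrightarrow> left_perp R (right_perp R \<T>) = \<T>"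
  by (auto simp: torsion_classes_def torsion_pair_def)

lemma torsion_class_subset: "\<T> \<in> torsion_classes R \<Longrightarrow> \<T> \<subseteq> mod_cat R"
  using torsion_class_double_perp left_perp_subset by metis

text \<open>The two perps form a Galois connection, so a threefold perp collapses to a single one.
  All torsion classes constructed below arise as left perps.\<close>

lemma left_perp_torsion_class:
  assumes "\<V> \<subseteq> mod_cat R"
  shows "left_perp R \<V> \<in> torsion_classes R"
proof -
  have "left_perp R (right_perp R (left_perp R \<V>)) = left_perp R \<V>"
    using assms by (fastforce simp: left_perp_def right_perp_def)
  then show ?thesis by (auto simp: torsion_classes_def torsion_pair_def)
qed

lemma left_perp_antimono: "\<V> \<subseteq> \<W> \<Longrightarrow> left_perp R \<W> \<subseteq> left_perp R \<V>"
  and right_perp_antimono: "\<V> \<subseteq> \<W> \<Longrightarrow> right_perp R \<W> \<subseteq> right_perp R \<V>"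
  by (auto simp: left_perp_def right_perp_def)

text \<open>This makes \<open>zero_mods R\<close> a valid lower end of intervals, and it shows that
  a module outside a torsion class is nonzero.\<close>

lemma torsion_class_zero:
  assumes "\<T> \<in> torsion_classes R"
  shows "zero_mods R \<subseteq> \<T>"
proof
  fix M assume "M \<in> zero_mods R"
  then show "M \<in> \<T>"
    using left_perp_zero[of M R "right_perp R \<T>"] torsion_class_double_perp[OF assms] right_perp_subset
    by (auto simp: zero_mods_def)
qed

lemma torsion_class_quotient:
  assumes "\<T> \<in> torsion_classes R" "L \<in> \<T>" "Y \<in> mod_cat R" "p \<in> mod_hom R L Y"
    "p ` carrier L = carrier Y"
  shows "Y \<in> \<T>"
  using left_perp_quotient[of L R "right_perp R \<T>" Y p] torsion_class_double_perp assms by metis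

lemma torsion_class_extension:
  assumes "\<T> \<in> torsion_classes R" "L \<in> mod_cat R" "I \<in> \<T>" "Y \<in> \<T>" "i \<in> mod_hom R I L"
    "p \<in> mod_hom R L Y" "p ` carrier L = carrier Y"
    "\<And>x. x \<in> carrier L \<Longrightarrow> p x = \<zero>\<^bsub>Y\<^esub> \<Longrightarrow> x \<in> i ` carrier I"
  shows "L \<in> \<T>"
  using left_perp_extension[of L R I "right_perp R \<T>" Y i p]
    torsion_class_double_perp[OF assms(1)] assms right_perp_subset by metis

lemma inter_torsion_class:
  assumes "\<T> \<in> torsion_classes R" "\<U> \<in> torsion_classes R"
  shows "\<T> \<inter> \<U> \<in> torsion_classes R"
proof -
  have "\<T> \<inter> \<U> = left_perp R (right_perp R \<T>) \<inter> left_perp R (right_perp R \<U>)"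
    using assms by (simp add: torsion_class_double_perp)
  also have "\<dots> = left_perp R (right_perp R \<T> \<union> right_perp R \<U>)"
    by (auto simp: left_perp_def)
  also have "\<dots> \<in> torsion_classes R"
    using right_perp_subset by (intro left_perp_torsion_class) auto
  finally show ?thesis .
qed

lemma tors_sel [simp]: "carrier (tors R) = torsion_classes R" "le (tors R) = (\<subseteq>)" "eq (tors R) = (=)"
  by (simp_all add: tors_def)

lemma tors_meet:
  assumes "\<T> \<in> torsion_classes R" "\<U> \<in> torsion_classes R"
  shows "\<T> \<sqinter>\<^bsub>tors R\<^esub> \<U> = \<T> \<inter> \<U>"
proof -
  interpret complete_lattice "tors R" by (rule tors_complete_lattice)
  have "\<T> \<sqinter>\<^bsub>tors R\<^esub> \<U> \<subseteq> \<T>" "\<T> \<sqinter>\<^bsub>tors R\<^esub> \<U> \<subseteq> \<U>"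
    using meet_left[of \<T> \<U>] meet_right[of \<T> \<U>] assms by auto
  moreover have "\<T> \<inter> \<U> \<subseteq> \<T> \<sqinter>\<^bsub>tors R\<^esub> \<U>"
    using meet_le[of "\<T> \<inter> \<U>" \<T> \<U>] assms inter_torsion_class by auto
  ultimately show ?thesis by blast
qed

text \<open>A torsion class is recovered from its right perp, and taking right perps reverses
  inclusions, so an upper bound of two torsion classes has its right perp inside both of
  theirs.\<close>

lemma tors_join:
  assumes "\<T> \<in> torsion_classes R" "\<U> \<in> torsion_classes R"
  shows "\<T> \<squnion>\<^bsub>tors R\<^esub> \<U> = left_perp R (right_perp R \<T> \<inter> right_perp R \<U>)" (is "?J = ?P")
proof -
  interpret complete_lattice "tors R" by (rule tors_complete_lattice)
  have "?P \<in> torsion_classes R" using right_perp_subset by (intro left_perp_torsion_class) auto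
  moreover have "\<T> \<subseteq> ?P" "\<U> \<subseteq> ?P"
    using torsion_class_subset assms by (fastforce simp: left_perp_def right_perp_def)+
  ultimately have "?J \<subseteq> ?P" using join_le[of \<T> ?P \<U>] assms by auto
  moreover have "?P \<subseteq> ?J"
  proof -
    have "\<T> \<subseteq> ?J" "\<U> \<subseteq> ?J" using join_left[of \<T> \<U>] join_right[of \<T> \<U>] assms by auto
    then have "?P \<subseteq> left_perp R (right_perp R ?J)"
      by (intro left_perp_antimono) (auto dest: right_perp_antimono)
    moreover have "?J \<in> torsion_classes R" using join_closed assms by auto
    ultimately show ?thesis by (simp add: torsion_class_double_perp)
  qed
  ultimately show ?thesis by blast
qed


section \<open>Bricks\<close>

lemma End_ring_sel [simp]:
  "carrier (End_ring R M) = mod_hom R M M"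
  "f \<otimes>\<^bsub>End_ring R M\<^esub> g = compose (carrier M) f g"
  "\<one>\<^bsub>End_ring R M\<^esub> = (\<lambda>x\<in>carrier M. x)"
  "\<zero>\<^bsub>End_ring R M\<^esub> = (\<lambda>x\<in>carrier M. \<zero>\<^bsub>M\<^esub>)"
  by (simp_all add: End_ring_def)

lemma bricks_subset: "bricks R \<subseteq> mod_cat R"
  by (auto simp: bricks_def)

text \<open>In a division algebra one differs from zero; here that says that the identity differs
  from the zero map.\<close>

lemma brick_nonzero: "B \<in> bricks R \<Longrightarrow> \<exists>x\<in>carrier B. x \<noteq> \<zero>\<^bsub>B\<^esub>"
  by (auto simp: bricks_def division_alg_def division_alg_axioms_def fun_eq_iff)
     metis

text \<open>The endomorphism is a nonzero element of a division algebra, and its ring inverse is an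
  inverse function.\<close>

lemma brick_endo_bij:
  assumes "B \<in> bricks R" "f \<in> mod_hom R B B" "x \<in> carrier B" "f x \<noteq> \<zero>\<^bsub>B\<^esub>"
  shows "bij_betw f (carrier B) (carrier B)"
proof -
  have "f \<noteq> \<zero>\<^bsub>End_ring R B\<^esub>" using assms(3,4) by auto
  moreover have "Units (End_ring R B) = carrier (End_ring R B) - {\<zero>\<^bsub>End_ring R B\<^esub>}"
    using assms(1) by (simp add: bricks_def division_alg_def division_alg_axioms_def)
  ultimately have "f \<in> Units (End_ring R B)" using assms(2) by simp
  then obtain g where g: "g \<in> mod_hom R B B" "compose (carrier B) g f = (\<lambda>x\<in>carrier B. x)"
    "compose (carrier B) f g = (\<lambda>x\<in>carrier B. x)"
    by (auto simp: Units_def)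
  have "g (f y) = y" "f (g y) = y" if "y \<in> carrier B" for y
    using fun_cong[OF g(2), of y] fun_cong[OF g(3), of y] that by (auto simp: compose_def)
  then show ?thesis
    using mod_hom_closed[OF g(1)] mod_hom_closed[OF assms(2)] by (intro bij_betw_byWitness[where f' = g]) auto
qed

text \<open>Converse of \<open>brick_endo_bij\<close>: the inverse function of a bijective
  endomorphism is again linear, so it is an inverse in the endomorphism ring. The nonzero element
  \<open>x\<close> separates one from zero.\<close>

lemma brickI:
  assumes "B \<in> mod_cat R" "x \<in> carrier B" "x \<noteq> \<zero>\<^bsub>B\<^esub>"
    and bij: "\<And>f y. \<lbrakk>f \<in> mod_hom R B B; y \<in> carrier B; f y \<noteq> \<zero>\<^bsub>B\<^esub>\<rbrakk>
      \<Longrightarrow> bij_betw f (carrier B) (carrier B)"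
  shows "B \<in> bricks R"
proof -
  note lm = mod_cat_left_module[OF assms(1)]
  interpret B: left_module R B by (rule lm)
  interpret E: ring "End_ring R B" by (rule B.End_ring_ring)
  have ne: "\<one>\<^bsub>End_ring R B\<^esub> \<noteq> \<zero>\<^bsub>End_ring R B\<^esub>"
    using assms(2,3) by (auto simp: fun_eq_iff intro!: exI[of _ x])
  have "f \<in> Units (End_ring R B)" if f: "f \<in> mod_hom R B B" and nz: "f \<noteq> \<zero>\<^bsub>End_ring R B\<^esub>" for f
  proof -
    have "\<not> is_zero_hom B B f" using nz by (simp add: is_zero_hom_def)
    then obtain y where "y \<in> carrier B" "f y \<noteq> \<zero>\<^bsub>B\<^esub>" using is_zero_hom_iff[OF f] by blast
    then have b: "bij_betw f (carrier B) (carrier B)" by (rule bij[OF f])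
    define h where "h = the_inv_into (carrier B) f"
    have h: "h (f z) = z" "f (h z) = z" "h z \<in> carrier B" if "z \<in> carrier B" for z
      using b that by (auto simp: h_def bij_betw_def the_inv_into_f_f f_the_inv_into_f
        intro: the_inv_into_into[where B = "carrier B", of f "carrier B", simplified])
    have "restrict h (carrier B) \<in> mod_hom R B B"
    proof (rule mod_hom_restrictI[OF _ _ _ lm])
      fix u v assume uv: "u \<in> carrier B" "v \<in> carrier B"
      then have "f (h u \<oplus>\<^bsub>B\<^esub> h v) = u \<oplus>\<^bsub>B\<^esub> v" by (simp add: mod_hom_add[OF f] h)
      then show "h (u \<oplus>\<^bsub>B\<^esub> v) = h u \<oplus>\<^bsub>B\<^esub> h v" using h uv by (metis B.add.m_closed)
    next
      fix a u assume au: "a \<in> carrier R" "u \<in> carrier B"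
      then have "f (a \<odot>\<^bsub>B\<^esub> h u) = a \<odot>\<^bsub>B\<^esub> u" by (simp add: mod_hom_smult[OF f] h)
      then show "h (a \<odot>\<^bsub>B\<^esub> u) = a \<odot>\<^bsub>B\<^esub> h u" using h au by (metis B.smult_closed)
    qed (simp add: h)
    then show ?thesis
      using f h mod_hom_closed[OF f]
      by (auto simp: Units_def compose_def fun_eq_iff intro!: bexI[of _ "restrict h (carrier B)"])
  qed
  moreover have "\<zero>\<^bsub>End_ring R B\<^esub> \<notin> Units (End_ring R B)"
    using ne E.Units_r_inv E.Units_inv_closed E.l_null by metis
  ultimately have "Units (End_ring R B) = carrier (End_ring R B) - {\<zero>\<^bsub>End_ring R B\<^esub>}"
    using E.Units_closed by auto
  then show ?thesis
    using assms(1) ne E.ring_axioms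
    by (simp add: bricks_def division_alg_def division_alg_axioms_def)
qed

text \<open>The composite of \<open>q\<close> and \<open>p\<close> is a nonzero endomorphism of a
  brick, hence bijective, which makes its first factor injective and its second surjective. A
  nonzero return trip through \<open>I\<close> thus exhibits \<open>B\<close> as a submodule and as
  a quotient of \<open>I\<close>.\<close>

lemma brick_factor:
  assumes "B \<in> bricks R" "p \<in> mod_hom R B I" "q \<in> mod_hom R I B" "x \<in> carrier B" "q (p x) \<noteq> \<zero>\<^bsub>B\<^esub>"
  shows "inj_on p (carrier B)" "q ` carrier I = carrier B"
proof -
  have B: "left_module R B" using assms(1) by (auto simp: bricks_def mod_cat_def)
  have "bij_betw (compose (carrier B) q p) (carrier B) (carrier B)"
    by (rule brick_endo_bij[OF assms(1) mod_hom_compose[OF B assms(2,3)] assms(4)])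
       (use assms in \<open>simp add: compose_def\<close>)
  then have *: "bij_betw (\<lambda>x. q (p x)) (carrier B) (carrier B)"
    by (simp add: compose_def bij_betw_def inj_on_def cong: image_cong)
  then show "inj_on p (carrier B)" by (auto simp: bij_betw_def inj_on_def)
  show "q ` carrier I = carrier B"
  proof
    show "q ` carrier I \<subseteq> carrier B" using mod_hom_closed[OF assms(3)] by auto
    have "carrier B = (\<lambda>x. q (p x)) ` carrier B" using * by (simp add: bij_betw_def)
    then show "carrier B \<subseteq> q ` carrier I" using mod_hom_closed[OF assms(2)] by blast
  qed
qed


section \<open>Vector spaces\<close>

lemma mod_span_mod_span: "mod_span R M (mod_span R M S) = mod_span R M S"
proof
  show "mod_span R M (mod_span R M S) \<subseteq> mod_span R M S" by (rule mod_span_least) simp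
qed (auto intro: mod_span.base)

lemma (in left_module) mod_span_solve_r:
  assumes "S \<subseteq> carrier M" "a \<in> carrier R" "y \<in> carrier M"
    "a \<odot>\<^bsub>M\<^esub> s \<oplus>\<^bsub>M\<^esub> y \<in> mod_span R M S" "s \<in> mod_span R M S"
  shows "y \<in> mod_span R M S"
proof -
  have s: "s \<in> carrier M" using assms mod_span_closed by blast
  have "(\<ominus> \<one>) \<odot>\<^bsub>M\<^esub> (a \<odot>\<^bsub>M\<^esub> s) \<oplus>\<^bsub>M\<^esub> (a \<odot>\<^bsub>M\<^esub> s \<oplus>\<^bsub>M\<^esub> y) = y"
    using assms(2,3) s by (simp add: smult_minus_one M.r_neg1)
  moreover have "(\<ominus> \<one>) \<odot>\<^bsub>M\<^esub> (a \<odot>\<^bsub>M\<^esub> s) \<oplus>\<^bsub>M\<^esub> (a \<odot>\<^bsub>M\<^esub> s \<oplus>\<^bsub>M\<^esub> y) \<in> mod_span R M S"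
    by (rule mod_span.add[OF mod_span.smult[OF _ mod_span.smult[OF assms(2,5)]] assms(4)]) simp
  ultimately show ?thesis by simp
qed

text \<open>Divide by the invertible coefficient. Over a field this covers every nonzero
  coefficient.\<close>

lemma (in left_module) mod_span_solve_l:
  assumes "S \<subseteq> carrier M" "a \<in> Units R" "s \<in> carrier M"
    "a \<odot>\<^bsub>M\<^esub> s \<oplus>\<^bsub>M\<^esub> y \<in> mod_span R M S" "y \<in> mod_span R M S"
  shows "s \<in> mod_span R M S"
proof -
  have y: "y \<in> carrier M" using assms mod_span_closed by blast
  have a: "a \<in> carrier R" "inv a \<in> carrier R" using assms(2) by auto
  \<comment> \<open>With coefficient one on \<open>y\<close>, the summands exchange their roles and
    \<open>mod_span_solve_r\<close> isolates the multiple of \<open>s\<close>.\<close>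
  have "\<one> \<odot>\<^bsub>M\<^esub> y \<oplus>\<^bsub>M\<^esub> a \<odot>\<^bsub>M\<^esub> s \<in> mod_span R M S"
    using assms(3,4) y a by (simp add: M.a_comm)
  from mod_span_solve_r[OF assms(1) _ _ this assms(5)] have "a \<odot>\<^bsub>M\<^esub> s \<in> mod_span R M S"
    using a assms(3) by simp
  from mod_span.smult[OF a(2) this] show ?thesis
    using assms(2,3) a by (simp add: smult_assoc[symmetric])
qed

text \<open>Steinitz exchange. In the induction the coefficient of the new generator is either zero,
  leaving \<open>x\<close> in the smaller span, or invertible, so that the generator can be solved
  for.\<close>

lemma mod_span_exchange:
  assumes "field K" "left_module K V" "finite S" "S \<subseteq> carrier V" "x \<in> mod_span K V S" "x \<noteq> \<zero>\<^bsub>V\<^esub>"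
  shows "\<exists>s\<in>S. s \<in> mod_span K V (insert x (S - {s}))"
  using assms(3-5)
proof (induction S)
  case empty
  interpret V: left_module K V by fact
  have "x = \<zero>\<^bsub>V\<^esub>" using empty(2) by induction auto
  with assms(6) show ?case by simp
next
  case (insert t S)
  interpret K: field K by fact
  interpret V: left_module K V by fact
  have xV: "x \<in> carrier V" using insert V.mod_span_closed by blast
  obtain a y where a: "a \<in> carrier K" "y \<in> mod_span K V S" "x = a \<odot>\<^bsub>V\<^esub> t \<oplus>\<^bsub>V\<^esub> y"
    using V.mod_span_insert[of t S x] insert by auto
  have yV: "y \<in> carrier V" using a(2) V.mod_span_closed[of S] insert by auto
  show ?case
  proof (cases "a = \<zero>\<^bsub>K\<^esub>")
    case True
    then have "x \<in> mod_span K V S" using a insert yV by simp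
    then obtain s where s: "s \<in> S" "s \<in> mod_span K V (insert x (S - {s}))"
      using insert by auto
    then show ?thesis
      using mod_span_mono[of "insert x (S - {s})" "insert x (insert t S - {s})" K V] by blast
  next
    case False
    then have u: "a \<in> Units K" using a(1) K.field_Units by simp
    have "t \<in> mod_span K V (insert x S)"
    proof (rule V.mod_span_solve_l[OF _ u])
      show "a \<odot>\<^bsub>V\<^esub> t \<oplus>\<^bsub>V\<^esub> y \<in> mod_span K V (insert x S)"
        unfolding a(3)[symmetric] by (auto intro: mod_span.base)
      show "y \<in> mod_span K V (insert x S)" using a(2) mod_span_mono[of S "insert x S" K V] by auto
    qed (use insert xV in auto)
    moreover have "insert t S - {t} = S" using insert by auto
    ultimately show ?thesis by auto
  qed
qed

text \<open>A nonzero kernel vector can replace some generator by exchange. Its image is zero, so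
  the quotient is spanned by the images of the remaining generators.\<close>

lemma quotient_span_less:
  assumes "field K" "left_module K V" "left_module K W" "p \<in> mod_hom K V W"
    "p ` carrier V = carrier W" "\<not> inj_on p (carrier V)"
    "finite S" "S \<subseteq> carrier V" "mod_span K V S = carrier V"
  shows "\<exists>T. finite T \<and> T \<subseteq> carrier W \<and> card T < card S \<and> mod_span K W T = carrier W"
proof -
  interpret V: left_module K V by fact
  note p0 = mod_hom_zero[OF assms(2-4)]
  obtain x where x: "x \<in> carrier V" "p x = \<zero>\<^bsub>W\<^esub>" "x \<noteq> \<zero>\<^bsub>V\<^esub>"
    using assms(6) mod_hom_inj_iff[OF assms(2-4)] by blast
  obtain s where s: "s \<in> S" "s \<in> mod_span K V (insert x (S - {s}))"
    using mod_span_exchange[OF assms(1,2,7,8)] x assms(9) by blast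
  define T where "T = p ` (S - {s})"
  have "S \<subseteq> mod_span K V (insert x (S - {s}))" using s(2) by (auto intro: mod_span.base)
  then have "mod_span K V (insert x (S - {s})) = carrier V"
    using mod_span_least[of S K V "insert x (S - {s})"] V.mod_span_closed[of "insert x (S - {s})"]
      x(1) assms(8,9) by auto
  then have "mod_span K W (p ` insert x (S - {s})) = carrier W"
    using x(1) assms(8) by (intro surj_span[OF assms(2,4,5) p0]) auto
  moreover have "mod_span K W (p ` insert x (S - {s})) \<subseteq> mod_span K W T"
    using x(2) by (intro mod_span_least) (auto simp: T_def intro: mod_span.base mod_span.zero)
  moreover have "T \<subseteq> carrier W" using assms(5,8) by (auto simp: T_def)
  moreover have "card T < card S"
    using card_image_le[of "S - {s}" p] card_Diff1_less[OF assms(7) s(1)] assms(7)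
    by (simp add: T_def)
  moreover have "mod_span K W T \<subseteq> carrier W"
    by (rule left_module.mod_span_closed[OF assms(3)]) fact
  ultimately show ?thesis using assms(7) by (intro exI[of _ T]) (auto simp: T_def)
qed

text \<open>As in echelon form: generators of the trace of \<open>V\<close> on the span of
  \<open>S\<close> come from the induction, and a single vector of \<open>V\<close> with nonzero
  coefficient at \<open>s\<close> supplies whatever is missing.\<close>

lemma subspace_span:
  assumes "field K" "left_module K W" "finite S" "S \<subseteq> carrier W"
    "V \<subseteq> mod_span K W S" "mod_span K W V = V"
  shows "\<exists>T. finite T \<and> T \<subseteq> V \<and> mod_span K W T = V \<and> card T \<le> card S \<and>
    (V \<noteq> mod_span K W S \<longrightarrow> card T < card S)"
  using assms(3-6)
proof (induction S arbitrary: V)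
  case empty
  have "mod_span K W {} \<subseteq> V" using mod_span_mono[of "{}" V K W] empty by auto
  then show ?case using empty by (intro exI[of _ "{}"]) auto
next
  case (insert s S V)
  interpret K: field K by fact
  interpret W: left_module K W by fact
  have sW: "s \<in> carrier W" and SW: "S \<subseteq> carrier W" using insert.prems by auto
  have VW: "V \<subseteq> carrier W" using insert.prems W.mod_span_closed[of "insert s S"] by auto
  define V' where "V' = V \<inter> mod_span K W S"
  have "mod_span K W V' \<subseteq> mod_span K W V" "mod_span K W V' \<subseteq> mod_span K W (mod_span K W S)"
    by (intro mod_span_mono; simp add: V'_def)+
  then have "mod_span K W V' = V'"
    using insert.prems(3) by (auto simp: V'_def mod_span_mod_span intro: mod_span.base)
  then obtain T where T: "finite T" "T \<subseteq> V'" "mod_span K W T = V'" "card T \<le> card S"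
    "V' \<noteq> mod_span K W S \<longrightarrow> card T < card S"
    using insert.IH[of V'] SW by (auto simp: V'_def)
  show ?case
  proof (cases "V \<subseteq> mod_span K W S")
    case True
    \<comment> \<open>Here \<open>V'\<close> is \<open>V\<close>, and dropping \<open>s\<close> from
      the generators already makes the bound strict.\<close>
    then show ?thesis
      using T insert.prems insert.hyps by (intro exI[of _ T]) (auto simp: V'_def Int_absorb2)
  next
    case False
    then obtain v where v: "v \<in> V" "v \<notin> mod_span K W S" by blast
    obtain a y where a: "a \<in> carrier K" "y \<in> mod_span K W S" "v = a \<odot>\<^bsub>W\<^esub> s \<oplus>\<^bsub>W\<^esub> y"
      using W.mod_span_insert[OF sW SW, of v] v insert.prems by blast
    have yW: "y \<in> carrier W" using a(2) W.mod_span_closed[OF SW] by auto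
    have "a \<noteq> \<zero>\<^bsub>K\<^esub>" using v a sW yW by auto
    then have u: "a \<in> Units K" using a(1) K.field_Units by simp
    have vW: "v \<in> carrier W" using v VW by auto
    have s_in: "s \<in> mod_span K W U" if "U \<subseteq> carrier W" "v \<in> mod_span K W U" "y \<in> mod_span K W U" for U
      using W.mod_span_solve_l[OF that(1) u sW _ that(3)] that(2) a(3) by simp
    have "s \<in> mod_span K W (insert v S)"
      using vW SW a(2) mod_span_mono[of S "insert v S" K W] by (intro s_in) (auto intro: mod_span.base)
    then have ins: "mod_span K W (insert s S) \<subseteq> mod_span K W (insert v S)"
      by (intro mod_span_least) (auto intro: mod_span.base)
    \<comment> \<open>After \<open>s\<close> is traded for \<open>v\<close>, subtracting a multiple
      of \<open>v\<close> from a vector of \<open>V\<close> leaves a vector of \<open>V\<close> in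
      the span of \<open>S\<close>, which \<open>T\<close> accounts for.\<close>
    have "V \<subseteq> mod_span K W (insert v T)"
    proof
      fix w assume w: "w \<in> V"
      then have "w \<in> mod_span K W (insert v S)" using ins insert.prems by auto
      then obtain c z where c: "c \<in> carrier K" "z \<in> mod_span K W S" "w = c \<odot>\<^bsub>W\<^esub> v \<oplus>\<^bsub>W\<^esub> z"
        using W.mod_span_insert[OF vW SW] by blast
      have "z \<in> mod_span K W V"
        using W.mod_span_solve_r[OF VW c(1), of z v] c w v W.mod_span_closed[OF SW] insert.prems by auto
      then have "z \<in> mod_span K W T" using c(2) T insert.prems by (auto simp: V'_def)
      then have "z \<in> mod_span K W (insert v T)" using mod_span_mono[of T "insert v T" K W] by auto
      then show "w \<in> mod_span K W (insert v T)"
        unfolding c(3) using c(1) by (intro mod_span.add mod_span.smult) (auto intro: mod_span.base)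
    qed
    moreover have "mod_span K W (insert v T) \<subseteq> V"
      using mod_span_mono[of "insert v T" V K W] v T insert.prems by (auto simp: V'_def)
    moreover have "V \<noteq> mod_span K W (insert s S) \<longrightarrow> card T < card S"
    proof
      assume ne: "V \<noteq> mod_span K W (insert s S)"
      \<comment> \<open>If \<open>V\<close> contained the span of \<open>S\<close>, it would contain
        \<open>y\<close>, hence \<open>s\<close>, and so the whole space.\<close>
      have "V' \<noteq> mod_span K W S"
      proof
        assume "V' = mod_span K W S"
        then have "mod_span K W S \<subseteq> V" by (auto simp: V'_def)
        moreover from this have "s \<in> V" using s_in[OF VW] v a(2) insert.prems by auto
        ultimately have "insert s S \<subseteq> mod_span K W V" using insert.prems by (auto intro: mod_span.base)
        then have "mod_span K W (insert s S) \<subseteq> V" using mod_span_least[of _ K W V] insert.prems by auto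
        then show False using ne insert.prems by auto
      qed
      then show "card T < card S" using T by simp
    qed
    moreover have "card (insert v T) \<le> Suc (card T)" by (simp add: card_insert_if T(1))
    ultimately show ?thesis
      using T v insert.prems insert.hyps by (intro exI[of _ "insert v T"]) (auto simp: V'_def)
  qed
qed

text \<open>A proper image would be spanned by fewer vectors than the smallest spanning set of
  \<open>V\<close>. Their preimages under the injection \<open>f\<close> would span
  \<open>V\<close>, against minimality.\<close>

lemma inj_endo_surj:
  assumes "field K" "left_module K V" "finite S" "S \<subseteq> carrier V" "mod_span K V S = carrier V"
    and f: "f \<in> mod_hom K V V" "inj_on f (carrier V)"
  shows "f ` carrier V = carrier V"
proof (rule ccontr)
  assume ne: "f ` carrier V \<noteq> carrier V"
  interpret V: left_module K V by fact
  note f0 = mod_hom_zero[OF assms(2,2) f(1)]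
  define P where "P S \<longleftrightarrow> finite S \<and> S \<subseteq> carrier V \<and> mod_span K V S = carrier V" for S
  have "P S" using assms by (simp add: P_def)
  then obtain S0 where S0: "P S0" "\<And>T. P T \<Longrightarrow> card S0 \<le> card T"
    using ex_has_least_nat[of P S card] by blast
  have "mod_span K V (carrier V) = carrier V"
    using V.mod_span_closed[of "carrier V"] by (auto intro: mod_span.base)
  then have "mod_span K V (f ` carrier V) = f ` carrier V"
    using mod_hom_image_span[OF assms(2) f(1) f0, of "carrier V"] by simp
  moreover have "f ` carrier V \<subseteq> carrier V" using mod_hom_closed[OF f(1)] by auto
  ultimately obtain T where T: "finite T" "T \<subseteq> f ` carrier V" "mod_span K V T = f ` carrier V"
    "card T < card S0"
    using subspace_span[OF assms(1,2), of S0 "f ` carrier V"] S0(1) ne by (auto simp: P_def)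
  then obtain T' where T': "T' \<subseteq> carrier V" "finite T'" "T = f ` T'"
    using finite_subset_image by metis
  have "card T' = card T"
    unfolding T'(3) using inj_on_subset[OF f(2) T'(1)] by (simp add: card_image)
  moreover have "P T'"
  proof -
    have "f ` mod_span K V T' = f ` carrier V"
      using mod_hom_image_span[OF assms(2) f(1) f0 T'(1)] T(3) T'(3) by simp
    then have "mod_span K V T' = carrier V"
      using inj_on_image_eq_iff[OF f(2)] V.mod_span_closed[OF T'(1)] by simp
    then show ?thesis using T' by (simp add: P_def)
  qed
  ultimately show False using S0(2) T(4) by fastforce
qed


section \<open>Restriction of scalars\<close>

text \<open>The underlying vector space of an \<open>A\<close>-module: \<open>K\<close> acts through
  the structure map sending \<open>c\<close> to \<open>c\<close> times the unit of
  \<open>A\<close>.\<close>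

definition restrict_scalars ::
    "('k, 'e) ring_scheme \<Rightarrow> ('k, 'a, 'f) module_scheme \<Rightarrow> ('a, 'm, 'g) module_scheme \<Rightarrow> ('k, 'm) module" where
  "restrict_scalars K A M =
     \<lparr>carrier = carrier M, monoid.mult = undefined, monoid.one = undefined,
      ring.zero = \<zero>\<^bsub>M\<^esub>, ring.add = add M, smult = (\<lambda>c x. (c \<odot>\<^bsub>A\<^esub> \<one>\<^bsub>A\<^esub>) \<odot>\<^bsub>M\<^esub> x)\<rparr>"

lemma restrict_scalars_sel [simp]:
  "carrier (restrict_scalars K A M) = carrier M"
  "\<zero>\<^bsub>restrict_scalars K A M\<^esub> = \<zero>\<^bsub>M\<^esub>"
  "x \<oplus>\<^bsub>restrict_scalars K A M\<^esub> y = x \<oplus>\<^bsub>M\<^esub> y"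
  "c \<odot>\<^bsub>restrict_scalars K A M\<^esub> x = (c \<odot>\<^bsub>A\<^esub> \<one>\<^bsub>A\<^esub>) \<odot>\<^bsub>M\<^esub> x"
  by (simp_all add: restrict_scalars_def)

context fin_dim_algebra
begin

lemma left_module_self: "left_module K A"
  by unfold_locales (auto simp: smult_l_distr smult_r_distr smult_assoc1)

lemma restrict_scalars_left_module:
  assumes "left_module A M"
  shows "left_module K (restrict_scalars K A M)"
proof -
  interpret M: left_module A M by fact
  have "abelian_group (restrict_scalars K A M)"
  proof (rule abelian_groupI)
    fix x assume "x \<in> carrier (restrict_scalars K A M)"
    then show "\<exists>y\<in>carrier (restrict_scalars K A M).
        y \<oplus>\<^bsub>restrict_scalars K A M\<^esub> x = \<zero>\<^bsub>restrict_scalars K A M\<^esub>"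
      by (auto intro!: bexI[of _ "\<ominus>\<^bsub>M\<^esub> x"] simp: M.M.l_neg)
  qed (auto simp: M.M.a_ac)
  then show ?thesis
    by (intro left_module.intro left_module_axioms.intro ring_axioms)
       (auto simp: smult_l_distr M.smult_l_distr M.smult_r_distr M.smult_assoc[symmetric]
         smult_mult_left smult_assoc1)
qed

lemma restrict_scalars_hom:
  "f \<in> mod_hom A M N \<Longrightarrow> f \<in> mod_hom K (restrict_scalars K A M) (restrict_scalars K A N)"
  by (auto simp: mod_hom_def)

text \<open>The products of vectors spanning \<open>A\<close> over \<open>K\<close> with generators
  of \<open>M\<close> over \<open>A\<close> span \<open>M\<close> over \<open>K\<close>: their
  linear span \<open>L\<close> is an \<open>A\<close>-submodule containing the generators.\<close>

lemma mod_cat_finite_span: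
  assumes "M \<in> mod_cat A"
  shows "\<exists>S. finite S \<and> S \<subseteq> carrier M \<and> mod_span K (restrict_scalars K A M) S = carrier M"
proof -
  interpret M: left_module A M by (rule mod_cat_left_module[OF assms])
  interpret KM: left_module K "restrict_scalars K A M"
    by (rule restrict_scalars_left_module[OF M.left_module_axioms])
  obtain E where E: "finite E" "E \<subseteq> carrier A" "mod_span K A E = carrier A"
    using left_module.finitely_generated_iff_span[OF left_module_self] fin_dim by blast
  obtain G where G: "finite G" "G \<subseteq> carrier M" "mod_span A M G = carrier M"
    using assms M.finitely_generated_iff_span by (auto simp: mod_cat_def)
  define S where "S = (\<lambda>(e, g). e \<odot>\<^bsub>M\<^esub> g) ` (E \<times> G)"
  have S: "finite S" "S \<subseteq> carrier M" using E G by (auto simp: S_def)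
  define L where "L = mod_span K (restrict_scalars K A M) S"
  have LM: "L \<subseteq> carrier M" using KM.mod_span_closed[of S] S by (simp add: L_def)
  have L_add: "x \<oplus>\<^bsub>M\<^esub> y \<in> L" if "x \<in> L" "y \<in> L" for x y
    using mod_span.add[of x K "restrict_scalars K A M" S y] that by (simp add: L_def)
  have L_smult: "(c \<odot>\<^bsub>A\<^esub> \<one>\<^bsub>A\<^esub>) \<odot>\<^bsub>M\<^esub> x \<in> L" if "c \<in> carrier K" "x \<in> L" for c x
    using mod_span.smult[of c K x "restrict_scalars K A M" S] that by (simp add: L_def)
  have L_zero: "\<zero>\<^bsub>M\<^esub> \<in> L"
    using mod_span.zero[of "restrict_scalars K A M" K S] by (simp add: L_def)
  have gen: "a \<odot>\<^bsub>M\<^esub> g \<in> L" if g: "g \<in> G" and "a \<in> carrier A" for a g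
  proof -
    have gM: "g \<in> carrier M" using g G by auto
    have "a \<in> mod_span K A E" using that E by simp
    \<comment> \<open>Membership in the carrier is carried through the induction because the laws of
      the action require it.\<close>
    then have "a \<in> carrier A \<and> a \<odot>\<^bsub>M\<^esub> g \<in> L"
    proof induction
      case zero
      then show ?case using gM L_zero by simp
    next
      case (base e)
      then show ?case using E g by (auto simp: L_def S_def intro: mod_span.base)
    next
      case (add a b)
      then show ?case using gM L_add by (simp add: M.smult_l_distr)
    next
      case (smult c a)
      then have "(c \<odot>\<^bsub>A\<^esub> a) \<odot>\<^bsub>M\<^esub> g = (c \<odot>\<^bsub>A\<^esub> \<one>\<^bsub>A\<^esub>) \<odot>\<^bsub>M\<^esub> (a \<odot>\<^bsub>M\<^esub> g)"
        using gM by (simp add: M.smult_assoc[symmetric] smult_mult_left)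
      then show ?case using smult L_smult by simp
    qed
    then show ?thesis ..
  qed
  have L_act: "a \<odot>\<^bsub>M\<^esub> x \<in> L" if a: "a \<in> carrier A" and "x \<in> L" for a x
    using that(2) unfolding L_def
  proof (induction, goal_cases)
    case 1
    then show ?case using a L_zero by (simp add: L_def)
  next
    case (2 x)
    then obtain e g where "e \<in> E" "g \<in> G" "x = e \<odot>\<^bsub>M\<^esub> g" by (auto simp: S_def)
    moreover from this have "a \<odot>\<^bsub>M\<^esub> x = (a \<otimes>\<^bsub>A\<^esub> e) \<odot>\<^bsub>M\<^esub> g"
      using a subsetD[OF E(2)] subsetD[OF G(2)] by (simp add: M.smult_assoc)
    moreover have "a \<otimes>\<^bsub>A\<^esub> e \<in> carrier A" if "e \<in> E" for e using a E that by auto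
    ultimately show ?case using gen by (simp add: L_def)
  next
    case (3 x y)
    then show ?case using LM a L_add by (auto simp: L_def[symmetric] M.smult_r_distr subset_iff)
  next
    case (4 c x)
    then have x: "x \<in> carrier M" using LM by (auto simp: L_def)
    \<comment> \<open>Scalar multiples of the unit are central in \<open>A\<close>, so the two
      actions commute.\<close>
    have "a \<odot>\<^bsub>M\<^esub> ((c \<odot>\<^bsub>A\<^esub> \<one>\<^bsub>A\<^esub>) \<odot>\<^bsub>M\<^esub> x) = (c \<odot>\<^bsub>A\<^esub> \<one>\<^bsub>A\<^esub>) \<odot>\<^bsub>M\<^esub> (a \<odot>\<^bsub>M\<^esub> x)"
      using x a 4(1) by (simp add: M.smult_assoc[symmetric] smult_mult_left smult_mult_right)
    then show ?case using L_smult[OF 4(1)] 4(3) by (simp add: L_def)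
  qed
  have "mod_span A M G \<subseteq> L"
  proof
    fix x assume "x \<in> mod_span A M G"
    then show "x \<in> L"
    proof induction
      case (base g)
      then show ?case using gen[of g "\<one>\<^bsub>A\<^esub>"] G by auto
    qed (simp_all add: L_zero L_add L_act)
  qed
  then have "mod_span K (restrict_scalars K A M) S = carrier M" using LM G by (auto simp: L_def)
  then show ?thesis using S by blast
qed

text \<open>The dimension over \<open>K\<close>, taken as the least size of a spanning set so that
  no bases are involved. It serves as a measure that drops along proper quotients.\<close>

definition kdim :: "('a, 'm, 'g) module_scheme \<Rightarrow> nat" where
  "kdim M = (LEAST n. \<exists>S. finite S \<and> S \<subseteq> carrier M \<and>
     mod_span K (restrict_scalars K A M) S = carrier M \<and> card S = n)"

lemma kdim_quotient_less:
  assumes "M \<in> mod_cat A" "N \<in> mod_cat A" "p \<in> mod_hom A M N" "p ` carrier M = carrier N"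
    "\<not> inj_on p (carrier M)"
  shows "kdim N < kdim M"
proof -
  have "\<exists>n S. finite S \<and> S \<subseteq> carrier M \<and> mod_span K (restrict_scalars K A M) S = carrier M \<and> card S = n"
    using mod_cat_finite_span[OF assms(1)] by blast
  from LeastI_ex[OF this] obtain S where S: "finite S" "S \<subseteq> carrier M"
    "mod_span K (restrict_scalars K A M) S = carrier M" "card S = kdim M"
    by (auto simp: kdim_def)
  note lm = mod_cat_left_module[OF assms(1)] mod_cat_left_module[OF assms(2)]
  obtain T where T: "finite T" "T \<subseteq> carrier N" "card T < card S"
    "mod_span K (restrict_scalars K A N) T = carrier N"
    using quotient_span_less[OF field_axioms restrict_scalars_left_module[OF lm(1)]
      restrict_scalars_left_module[OF lm(2)] restrict_scalars_hom[OF assms(3)], of S] assms(4,5) S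
    by auto
  have "kdim N \<le> card T" unfolding kdim_def by (rule Least_le) (use T in blast)
  then show ?thesis using T S by simp
qed

lemma mod_cat_inj_endo_surj:
  assumes "M \<in> mod_cat A" "f \<in> mod_hom A M M" "inj_on f (carrier M)"
  shows "f ` carrier M = carrier M"
  using mod_cat_finite_span[OF assms(1)] assms(3)
    inj_endo_surj[OF field_axioms restrict_scalars_left_module[OF mod_cat_left_module[OF assms(1)]]
      _ _ _ restrict_scalars_hom[OF assms(2)]]
  by auto

end


section \<open>Bricks and torsion classes\<close>

text \<open>By minimality of the dimension, every proper quotient of \<open>M\<close> lies in
  \<open>\<U>\<close>. Both orthogonality to \<open>\<U>\<close> and the brick property follow by
  exhibiting a proper quotient.\<close>

lemma (in fin_dim_algebra) brick_in_difference:
  assumes T: "\<T> \<in> torsion_classes A" and U: "\<U> \<in> torsion_classes A" and "\<not> \<T> \<subseteq> \<U>"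
  obtains B where "B \<in> bricks A" "B \<in> \<T>" "B \<in> right_perp A \<U>"
proof -
  obtain M0 where "M0 \<in> \<T> - \<U>" using assms(3) by blast
  then obtain M where M: "M \<in> \<T>" "M \<notin> \<U>"
    and least: "\<And>N. N \<in> \<T> \<Longrightarrow> N \<notin> \<U> \<Longrightarrow> kdim M \<le> kdim N"
    using ex_has_least_nat[of "\<lambda>N. N \<in> \<T> - \<U>" M0 kdim] by auto
  have Mc: "M \<in> mod_cat A" using M(1) torsion_class_subset[OF T] by auto
  have quot: "N \<in> \<U>"
    if "N \<in> mod_cat A" "p \<in> mod_hom A M N" "p ` carrier M = carrier N" "\<not> inj_on p (carrier M)" for N p
    using kdim_quotient_less[OF Mc that] least[of N] torsion_class_quotient[OF T M(1) that(1-3)]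
    by force
  have perp: "M \<in> right_perp A \<U>"
  proof -
    have "hom_zero A N M" if N: "N \<in> \<U>" for N
    proof (rule ccontr)
      assume "\<not> hom_zero A N M"
      then obtain f x where f: "f \<in> mod_hom A N M" "x \<in> carrier N" "f x \<noteq> \<zero>\<^bsub>M\<^esub>"
        by (rule not_hom_zeroE)
      have Nc: "N \<in> mod_cat A" using N torsion_class_subset[OF U] by auto
      obtain Q p where Q: "Q \<in> mod_cat A" "p \<in> mod_hom A M Q" "p ` carrier M = carrier Q"
        "\<And>x. x \<in> carrier M \<Longrightarrow> p x = \<zero>\<^bsub>Q\<^esub> \<longleftrightarrow> x \<in> f ` carrier N"
        \<comment> \<open>The cokernel of a nonzero map from \<open>\<U>\<close> is a proper
          quotient of \<open>M\<close>, hence in \<open>\<U>\<close>, so closure under extensions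
          would put \<open>M\<close> itself in \<open>\<U>\<close>.\<close>
        using mod_cat_quotient[OF Mc Nc f(1)] by blast
      have "p (f x) = \<zero>\<^bsub>Q\<^esub>" using Q(4) f mod_hom_closed[OF f(1)] by simp
      then have "\<not> inj_on p (carrier M)"
        using mod_hom_inj_iff[OF mod_cat_left_module[OF Mc] mod_cat_left_module[OF Q(1)] Q(2)]
          f mod_hom_closed[OF f(1)] by blast
      then have "Q \<in> \<U>" using quot Q by blast
      from torsion_class_extension[OF U Mc N this f(1) Q(2,3)] Q(4) show False using M(2) by blast
    qed
    then show ?thesis using Mc by (simp add: right_perp_def)
  qed
  interpret M: left_module A M by (rule mod_cat_left_module[OF Mc])
  have "M \<notin> zero_mods A" using M(2) torsion_class_zero[OF U] by auto
  then obtain x where x: "x \<in> carrier M" "x \<noteq> \<zero>\<^bsub>M\<^esub>" using Mc by (auto simp: zero_mods_def)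
  have "M \<in> bricks A"
  proof (rule brickI[OF Mc x])
    fix f y assume f: "f \<in> mod_hom A M M" "y \<in> carrier M" "f y \<noteq> \<zero>\<^bsub>M\<^esub>"
    have "inj_on f (carrier M)"
    proof (rule ccontr)
      \<comment> \<open>The image of a noninjective endomorphism is a proper quotient, so it lies in
        \<open>\<U>\<close>. As a submodule of \<open>M\<close> it also lies in the right perp of
        \<open>\<U>\<close>, so it is zero.\<close>
      assume inj: "\<not> inj_on f (carrier M)"
      obtain I where I: "I \<in> mod_cat A" "carrier I = f ` carrier M" "\<zero>\<^bsub>I\<^esub> = \<zero>\<^bsub>M\<^esub>"
        "f \<in> mod_hom A M I" "(\<lambda>x\<in>carrier I. x) \<in> mod_hom A I M"
        by (rule mod_cat_image[OF Mc Mc f(1)])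
      have "I \<in> \<U>" using quot[OF I(1,4) _ inj] I(2) by simp
      moreover have "I \<in> right_perp A \<U>"
        by (rule right_perp_submodule[OF perp I(1,5)]) (simp_all add: torsion_class_subset[OF U])
      ultimately have "hom_zero A I I" by (simp add: right_perp_def)
      with hom_zero_self[OF mod_cat_left_module[OF I(1)], of "f y"] I f show False by simp
    qed
    then show "bij_betw f (carrier M) (carrier M)"
      using mod_cat_inj_endo_surj[OF Mc f(1)] by (simp add: bij_betw_def)
  qed
  then show thesis using that M perp by blast
qed

section \<open>Torsion classes just below and just above those attached to a brick\<close>

definition torsion_closure ::
    "('a, 'e) ring_scheme \<Rightarrow> ('a, 'a list) module \<Rightarrow> ('a, 'a list) module set" where
  "torsion_closure R B = left_perp R (right_perp R {B})"

lemma torsion_closure_torsion_class: "torsion_closure R B \<in> torsion_classes R"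
  unfolding torsion_closure_def by (rule left_perp_torsion_class[OF right_perp_subset])

lemma torsion_closure_self: "B \<in> mod_cat R \<Longrightarrow> B \<in> torsion_closure R B"
  by (auto simp: torsion_closure_def left_perp_def right_perp_def)

lemma torsion_closure_least:
  assumes "\<T> \<in> torsion_classes R" "B \<in> \<T>"
  shows "torsion_closure R B \<subseteq> \<T>"
proof -
  have "torsion_closure R B \<subseteq> left_perp R (right_perp R \<T>)"
    unfolding torsion_closure_def using assms(2)
    by (intro left_perp_antimono right_perp_antimono) auto
  then show ?thesis using torsion_class_double_perp[OF assms(1)] by simp
qed

lemma brick_not_self_orthogonal:
  assumes "B \<in> bricks R"
  shows "\<not> hom_zero R B B"
  using brick_nonzero[OF assms] hom_zero_self[of R B] assms bricks_subset mod_cat_left_module by blast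

lemma brick_not_left_perp: "B \<in> bricks R \<Longrightarrow> B \<notin> left_perp R {B}"
  using brick_not_self_orthogonal by (auto simp: left_perp_def)

text \<open>The image of a nonzero map from \<open>\<U>\<close> to \<open>B\<close> is a nonzero
  module of \<open>\<U>\<close>, hence of \<open>torsion_closure R B\<close>, so it receives a
  nonzero map from \<open>B\<close>. Following this by the inclusion into \<open>B\<close> gives a
  nonzero endomorphism, so the inclusion is onto and \<open>B\<close> would lie in
  \<open>\<U>\<close>.\<close>

lemma below_torsion_closure:
  assumes B: "B \<in> bricks R" and U: "\<U> \<in> torsion_classes R" "\<U> \<subseteq> torsion_closure R B" "B \<notin> \<U>"
  shows "\<U> \<subseteq> left_perp R {B}"
proof
  fix M assume M: "M \<in> \<U>"
  have Mc: "M \<in> mod_cat R" using M torsion_class_subset[OF U(1)] by auto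
  have Bc: "B \<in> mod_cat R" using B bricks_subset by auto
  have "hom_zero R M B"
  proof (rule ccontr)
    assume "\<not> hom_zero R M B"
    then obtain f x where f: "f \<in> mod_hom R M B" "x \<in> carrier M" "f x \<noteq> \<zero>\<^bsub>B\<^esub>"
      by (rule not_hom_zeroE)
    obtain I where I: "I \<in> mod_cat R" "carrier I = f ` carrier M" "\<zero>\<^bsub>I\<^esub> = \<zero>\<^bsub>B\<^esub>"
      "f \<in> mod_hom R M I" "(\<lambda>x\<in>carrier I. x) \<in> mod_hom R I B"
      by (rule mod_cat_image[OF Mc Bc f(1)])
    have IU: "I \<in> \<U>" by (rule torsion_class_quotient[OF U(1) M I(1,4)]) (simp add: I)
    have "\<not> hom_zero R I I"
      using hom_zero_self[OF mod_cat_left_module[OF I(1)], of "f x"] I f by auto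
    then have "I \<notin> right_perp R {B}"
      using IU U(2) by (auto simp: torsion_closure_def left_perp_def)
    then have "\<not> hom_zero R B I" using I(1) by (simp add: right_perp_def)
    then obtain p z where p: "p \<in> mod_hom R B I" "z \<in> carrier B" "p z \<noteq> \<zero>\<^bsub>I\<^esub>"
      by (rule not_hom_zeroE)
    have "(\<lambda>x\<in>carrier I. x) ` carrier I = carrier B"
      by (rule brick_factor(2)[OF B p(1) I(5) p(2)]) (use p mod_hom_closed[OF p(1,2)] I(3) in simp)
    then have "B \<in> \<U>" by (rule torsion_class_quotient[OF U(1) IU Bc I(5)])
    then show False using U(3) by simp
  qed
  then show "M \<in> left_perp R {B}" using Mc by (simp add: left_perp_def)
qed

text \<open>Dual argument with submodules: the image of a nonzero map from \<open>B\<close> to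
  \<open>M\<close> lies in the right perp of \<open>\<W>\<close>, so it is not in the left perp of
  \<open>B\<close> and maps nontrivially back to \<open>B\<close>. Then \<open>B\<close> embeds in
  \<open>M\<close>, which forces \<open>\<W>\<close> into the left perp of \<open>B\<close>. Right
  perps appear because joins are computed from them.\<close>

lemma above_left_perp_brick:
  assumes B: "B \<in> bricks R" and W: "\<W> \<in> torsion_classes R" "left_perp R {B} \<subseteq> \<W>"
    "\<W> \<noteq> left_perp R {B}"
  shows "right_perp R \<W> \<subseteq> right_perp R {B}"
proof
  fix M assume M: "M \<in> right_perp R \<W>"
  have Mc: "M \<in> mod_cat R" using M right_perp_subset by auto
  have Bc: "B \<in> mod_cat R" using B bricks_subset by auto
  note Wc = torsion_class_subset[OF W(1)]
  have "hom_zero R B M"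
  proof (rule ccontr)
    assume "\<not> hom_zero R B M"
    then obtain f x where f: "f \<in> mod_hom R B M" "x \<in> carrier B" "f x \<noteq> \<zero>\<^bsub>M\<^esub>"
      by (rule not_hom_zeroE)
    obtain I where I: "I \<in> mod_cat R" "carrier I = f ` carrier B" "\<zero>\<^bsub>I\<^esub> = \<zero>\<^bsub>M\<^esub>"
      "f \<in> mod_hom R B I" "(\<lambda>x\<in>carrier I. x) \<in> mod_hom R I M"
      by (rule mod_cat_image[OF Bc Mc f(1)])
    have IW: "I \<in> right_perp R \<W>"
      by (rule right_perp_submodule[OF M I(1,5) _ Wc]) simp
    have "\<not> hom_zero R I I"
      using hom_zero_self[OF mod_cat_left_module[OF I(1)], of "f x"] I f by auto
    then have "I \<notin> left_perp R {B}" using IW W(2) by (auto simp: right_perp_def)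
    then have "\<not> hom_zero R I B" using I(1) by (simp add: left_perp_def)
    then obtain q u where q: "q \<in> mod_hom R I B" "u \<in> carrier I" "q u \<noteq> \<zero>\<^bsub>B\<^esub>"
      by (rule not_hom_zeroE)
    then obtain z where z: "z \<in> carrier B" "q (f z) \<noteq> \<zero>\<^bsub>B\<^esub>" using I(2) by auto
    have "inj_on f (carrier B)" by (rule brick_factor(1)[OF B I(4) q(1) z])
    then have "B \<in> right_perp R \<W>" by (rule right_perp_submodule[OF M Bc f(1) _ Wc])
    then have "\<W> \<subseteq> left_perp R {B}" using Wc by (auto simp: right_perp_def left_perp_def)
    then show False using W(2,3) by blast
  qed
  then show "M \<in> right_perp R {B}" using Mc by (simp add: right_perp_def)
qed

section \<open>Arrows of intervals and their labels\<close>

lemma tors_interval_sel [simp]: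
  "carrier (tors_interval R \<U> \<T>) = {\<W> \<in> torsion_classes R. \<U> \<subseteq> \<W> \<and> \<W> \<subseteq> \<T>}"
  "le (tors_interval R \<U> \<T>) = (\<subseteq>)" "eq (tors_interval R \<U> \<T>) = (=)"
  by (auto simp: tors_interval_def at_least_at_most_def)

text \<open>Intervals are convex: anything strictly between two members is a member, so covers in an
  interval are covers in the whole lattice.\<close>

lemma hasse_arrow_tors_interval_iff:
  "(\<T>, \<U>) \<in> hasse_arrows (tors_interval R \<C> \<D>) \<longleftrightarrow>
    \<T> \<in> torsion_classes R \<and> \<U> \<in> torsion_classes R \<and> \<C> \<subseteq> \<U> \<and> \<T> \<subseteq> \<D> \<and> \<U> \<subset> \<T> \<and>
    \<not> (\<exists>\<W>\<in>torsion_classes R. \<U> \<subset> \<W> \<and> \<W> \<subset> \<T>)"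
  by (simp add: hasse_arrows_def lless_def psubset_eq) (meson order.trans)

lemma brick_labels_arrow_below:
  assumes B: "B \<in> bricks R" and T: "\<T> \<in> torsion_classes R" "B \<in> \<T>"
  shows "\<exists>\<alpha>\<in>hasse_arrows (tors_interval R (zero_mods R) \<T>). labels R B \<alpha>"
proof
  have Bc: "B \<in> mod_cat R" using B bricks_subset by auto
  define \<U> where "\<U> = torsion_closure R B \<inter> left_perp R {B}"
  have U: "\<U> \<in> torsion_classes R"
    unfolding \<U>_def using Bc
    by (intro inter_torsion_class torsion_closure_torsion_class left_perp_torsion_class) auto
  have BU: "B \<notin> \<U>" using brick_not_left_perp[OF B] by (simp add: \<U>_def)
  \<comment> \<open>A torsion class in between either contains \<open>B\<close>, hence all of
    \<open>torsion_closure R B\<close>, or misses \<open>B\<close> and then lies in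
    \<open>\<U>\<close> by \<open>below_torsion_closure\<close>.\<close>
  have "\<not> (\<U> \<subset> \<W> \<and> \<W> \<subset> torsion_closure R B)" if W: "\<W> \<in> torsion_classes R" for \<W>
  proof
    assume *: "\<U> \<subset> \<W> \<and> \<W> \<subset> torsion_closure R B"
    then have "B \<notin> \<W>" using torsion_closure_least[OF W] by blast
    then have "\<W> \<subseteq> \<U>" using below_torsion_closure[OF B W] * by (auto simp: \<U>_def)
    then show False using * by blast
  qed
  then show "(torsion_closure R B, \<U>) \<in> hasse_arrows (tors_interval R (zero_mods R) \<T>)"
    using U torsion_closure_torsion_class[of R B] torsion_class_zero[OF U] torsion_closure_least[OF T]
      BU torsion_closure_self[OF Bc]
    by (auto simp: hasse_arrow_tors_interval_iff \<U>_def)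
  have "B \<in> right_perp R \<U>" using Bc by (auto simp: right_perp_def left_perp_def \<U>_def)
  then show "labels R B (torsion_closure R B, \<U>)"
    using B torsion_closure_self[OF Bc] by (simp add: labels_def)
qed

lemma brick_labels_arrow_above:
  assumes B: "B \<in> bricks R" and T: "\<T> \<in> torsion_classes R" "B \<in> right_perp R \<T>"
  shows "\<exists>\<alpha>\<in>hasse_arrows (tors_interval R \<T> (mod_cat R)). labels R B \<alpha>"
proof
  have Bc: "B \<in> mod_cat R" using B bricks_subset by auto
  \<comment> \<open>The smallest torsion class containing both \<open>left_perp R {B}\<close> and
    \<open>B\<close>, written as in \<open>tors_join\<close>; it is the upper cover.\<close>
  define \<V> where "\<V> = left_perp R (right_perp R (left_perp R {B}) \<inter> right_perp R {B})"
  have V: "\<V> \<in> torsion_classes R"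
    unfolding \<V>_def using right_perp_subset by (intro left_perp_torsion_class) auto
  have P: "left_perp R {B} \<in> torsion_classes R" using Bc by (intro left_perp_torsion_class) auto
  have BV: "B \<in> \<V>" using Bc by (auto simp: \<V>_def left_perp_def right_perp_def)
  have "left_perp R {B} \<subseteq> \<V>" by (auto simp: \<V>_def left_perp_def right_perp_def)
  then have psub: "left_perp R {B} \<subset> \<V>" using BV brick_not_left_perp[OF B] by blast
  have "\<not> (left_perp R {B} \<subset> \<W> \<and> \<W> \<subset> \<V>)" if W: "\<W> \<in> torsion_classes R" for \<W>
  proof
    assume *: "left_perp R {B} \<subset> \<W> \<and> \<W> \<subset> \<V>"
    then have "right_perp R \<W> \<subseteq> right_perp R {B}" by (intro above_left_perp_brick[OF B W]) auto
    moreover have "right_perp R \<W> \<subseteq> right_perp R (left_perp R {B})"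
      using * by (intro right_perp_antimono) auto
    ultimately have "\<V> \<subseteq> left_perp R (right_perp R \<W>)"
      unfolding \<V>_def by (intro left_perp_antimono) auto
    then show False using * torsion_class_double_perp[OF W] by auto
  qed
  \<comment> \<open>Orthogonality of \<open>B\<close> to \<open>\<T>\<close>, read from the other
    side, places the arrow in the interval above \<open>\<T>\<close>.\<close>
  moreover have "\<T> \<subseteq> left_perp R {B}"
    using T(2) torsion_class_subset[OF T(1)] by (auto simp: right_perp_def left_perp_def)
  ultimately show "(\<V>, left_perp R {B}) \<in> hasse_arrows (tors_interval R \<T> (mod_cat R))"
    using V P psub torsion_class_subset[OF V] by (auto simp: hasse_arrow_tors_interval_iff)
  have "B \<in> right_perp R (left_perp R {B})" using Bc by (auto simp: right_perp_def left_perp_def)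
  then show "labels R B (\<V>, left_perp R {B})" using B BV by (simp add: labels_def)
qed

section \<open>Left modularity expressed by perps, and its relation to bricks\<close>

lemma left_modular_tors_iff:
  assumes "\<C> \<in> torsion_classes R"
  shows "left_modular (tors R) \<C> \<longleftrightarrow>
    (\<forall>\<D>\<in>torsion_classes R. \<forall>\<E>\<in>torsion_classes R. \<D> \<subseteq> \<E> \<longrightarrow>
      left_perp R (right_perp R \<D> \<inter> right_perp R \<C>) \<inter> \<E> =
      left_perp R (right_perp R \<D> \<inter> right_perp R (\<C> \<inter> \<E>)))"
proof -
  have "left_perp R (right_perp R \<D> \<inter> right_perp R \<E>) \<in> torsion_classes R" for \<D> \<E>
    using right_perp_subset by (intro left_perp_torsion_class) auto
  then show ?thesis
    using assms by (simp add: left_modular_def tors_join tors_meet inter_torsion_class)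
qed

lemma (in fin_dim_algebra) brick_splitting_left_modular:
  assumes T: "\<T> \<in> torsion_classes A" and split: "\<And>B. B \<in> bricks A \<Longrightarrow> B \<in> \<T> \<or> B \<in> right_perp A \<T>"
  shows "left_modular (tors A) \<T>"
  unfolding left_modular_tors_iff[OF T]
proof (intro ballI impI)
  fix \<D> \<E> assume YZ: "\<D> \<in> torsion_classes A" "\<E> \<in> torsion_classes A" "\<D> \<subseteq> \<E>"
  let ?L = "left_perp A (right_perp A \<D> \<inter> right_perp A \<T>) \<inter> \<E>"
  let ?R = "left_perp A (right_perp A \<D> \<inter> right_perp A (\<T> \<inter> \<E>))"
  \<comment> \<open>The inclusion of \<open>?R\<close> in \<open>?L\<close> is the modular
    inequality of any lattice; only the reverse inclusion uses the bricks.\<close>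
  have "?R \<subseteq> left_perp A (right_perp A \<D> \<inter> right_perp A \<T>)"
    by (intro left_perp_antimono Int_mono right_perp_antimono) auto
  moreover have "?R \<subseteq> left_perp A (right_perp A \<E>)"
    using YZ(3) by (intro left_perp_antimono Int_greatest right_perp_antimono) auto
  moreover have "?L \<subseteq> ?R"
  proof (rule ccontr)
    assume ne: "\<not> ?L \<subseteq> ?R"
    have LR: "?L \<in> torsion_classes A" "?R \<in> torsion_classes A"
      using right_perp_subset YZ by (auto intro!: left_perp_torsion_class inter_torsion_class)
    obtain B where B: "B \<in> bricks A" "B \<in> ?L" "B \<in> right_perp A ?R"
      by (rule brick_in_difference[OF LR ne])
    have nz: "\<not> hom_zero A B B" by (rule brick_not_self_orthogonal[OF B(1)])
    have sub: "\<D> \<subseteq> ?R" "\<T> \<inter> \<E> \<subseteq> ?R"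
      using torsion_class_subset YZ(1) T by (fastforce simp: left_perp_def right_perp_def)+
    then have BY: "B \<in> right_perp A \<D>" and BTZ: "B \<in> right_perp A (\<T> \<inter> \<E>)"
      using B(3) right_perp_antimono by blast+
    \<comment> \<open>Either way \<open>B\<close> becomes orthogonal to itself: in
      \<open>\<T>\<close> it belongs to \<open>\<T> \<inter> \<E>\<close>, to which it is
      orthogonal; in the right perp it belongs to both right perps whose intersection defines the
      join containing it.\<close>
    from split[OF B(1)] show False
    proof
      assume "B \<in> \<T>"
      then show False using B(2) BTZ nz by (auto simp: right_perp_def)
    next
      assume "B \<in> right_perp A \<T>"
      then show False using B(2) BY nz by (auto simp: left_perp_def)
    qed
  qed
  ultimately show "?L = ?R" using torsion_class_double_perp[OF YZ(2)] by auto
qed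

lemma left_modular_brick_splitting:
  assumes T: "\<T> \<in> torsion_classes R" and lm: "left_modular (tors R) \<T>"
    and B: "B \<in> bricks R" "B \<notin> \<T>"
  shows "B \<in> right_perp R \<T>"
proof (rule ccontr)
  assume nB: "B \<notin> right_perp R \<T>"
  have Bc: "B \<in> mod_cat R" using B bricks_subset by auto
  define \<E> where "\<E> = torsion_closure R B"
  define \<D> where "\<D> = \<E> \<inter> left_perp R {B}"
  have Z: "\<E> \<in> torsion_classes R" by (simp add: \<E>_def torsion_closure_torsion_class)
  have Y: "\<D> \<in> torsion_classes R"
    unfolding \<D>_def using Z Bc by (intro inter_torsion_class left_perp_torsion_class) auto
  have BZ: "B \<in> \<E>" by (simp add: \<E>_def torsion_closure_self[OF Bc])
  have eq: "left_perp R (right_perp R \<D> \<inter> right_perp R \<T>) \<inter> \<E> =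
      left_perp R (right_perp R \<D> \<inter> right_perp R (\<T> \<inter> \<E>))" (is "?J \<inter> _ = ?R")
    using lm[unfolded left_modular_tors_iff[OF T]] Y Z by (auto simp: \<D>_def)
  have "\<T> \<inter> \<E> \<subseteq> \<D>"
    using below_torsion_closure[OF B(1) inter_torsion_class[OF T Z]] B(2)
    by (auto simp: \<D>_def \<E>_def)
  \<comment> \<open>Joining with a torsion class inside \<open>\<D>\<close> adds nothing, so the
    right-hand side stays in \<open>\<D>\<close> and misses \<open>B\<close>.\<close>
  then have "?R \<subseteq> left_perp R (right_perp R \<D>)"
    by (intro left_perp_antimono Int_greatest right_perp_antimono) auto
  then have "?R \<subseteq> left_perp R {B}" using torsion_class_double_perp[OF Y] by (auto simp: \<D>_def)
  then have BR: "B \<notin> ?R" using brick_not_left_perp[OF B(1)] by auto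
  obtain N where N: "N \<in> \<T>" "\<not> hom_zero R N B" using nB Bc by (auto simp: right_perp_def)
  obtain f x where f: "f \<in> mod_hom R N B" "x \<in> carrier N" "f x \<noteq> \<zero>\<^bsub>B\<^esub>"
    using N(2) by (rule not_hom_zeroE)
  have Nc: "N \<in> mod_cat R" using N(1) torsion_class_subset[OF T] by auto
  obtain Q p where Q: "Q \<in> mod_cat R" "p \<in> mod_hom R B Q" "p ` carrier B = carrier Q"
    "\<And>x. x \<in> carrier B \<Longrightarrow> p x = \<zero>\<^bsub>Q\<^esub> \<longleftrightarrow> x \<in> f ` carrier N"
    using mod_cat_quotient[OF Bc Nc f(1)] by blast
  \<comment> \<open>A nonzero map from \<open>Q\<close> back to \<open>B\<close> would make
    \<open>p\<close> injective by \<open>brick_factor\<close>, although \<open>p\<close> kills the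
    nonzero element \<open>f x\<close>.\<close>
  have "hom_zero R Q B"
  proof (rule ccontr)
    assume "\<not> hom_zero R Q B"
    then obtain g u where g: "g \<in> mod_hom R Q B" "u \<in> carrier Q" "g u \<noteq> \<zero>\<^bsub>B\<^esub>"
      by (rule not_hom_zeroE)
    then obtain z where z: "z \<in> carrier B" "g (p z) \<noteq> \<zero>\<^bsub>B\<^esub>" using Q(3) by (metis imageE)
    have "inj_on p (carrier B)" by (rule brick_factor(1)[OF B(1) Q(2) g(1) z])
    moreover have "f x \<in> carrier B" "p (f x) = \<zero>\<^bsub>Q\<^esub>"
      using Q(4) f(2) mod_hom_closed[OF f(1,2)] by auto
    ultimately show False
      using mod_hom_inj_iff[OF mod_cat_left_module[OF Bc] mod_cat_left_module[OF Q(1)] Q(2)] f(3)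
      by blast
  qed
  then have "Q \<in> \<D>"
    using Q(1) torsion_class_quotient[OF Z BZ Q(1-3)] by (simp add: \<D>_def left_perp_def)
  moreover have J: "?J \<in> torsion_classes R"
    using right_perp_subset by (intro left_perp_torsion_class) auto
  moreover have "\<D> \<subseteq> ?J" "\<T> \<subseteq> ?J"
    using torsion_class_subset Y T by (fastforce simp: left_perp_def right_perp_def)+
  \<comment> \<open>\<open>B\<close> is an extension of \<open>Q\<close>, from \<open>\<D>\<close>,
    by the image of \<open>N\<close>, from \<open>\<T>\<close>; both classes lie below the
    join.\<close>
  ultimately have "B \<in> ?J"
    using torsion_class_extension[OF J Bc, of N Q f p] N(1) f(1) Q(2-4) by blast
  then show False using BZ BR eq by blast
qed

theorem theorem1p1:
  fixes K :: "('k, 'e) ring_scheme" and A :: "('k, 'a, 'f) module_scheme"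
    and \<T> \<F> :: "('a, 'a list) module set"
  assumes "fin_dim_algebra K A"
    and "torsion_pair A \<T> \<F>"
  shows "(brick_splitting A \<T> \<F> \<longleftrightarrow>
           (\<forall>B\<in>bricks A.
              \<exists>\<alpha>\<in>hasse_arrows (tors_interval A (zero_mods A) \<T>)
                 \<union> hasse_arrows (tors_interval A \<T> (mod_cat A)). labels A B \<alpha>))
       \<and> ((\<forall>B\<in>bricks A.
              \<exists>\<alpha>\<in>hasse_arrows (tors_interval A (zero_mods A) \<T>)
                 \<union> hasse_arrows (tors_interval A \<T> (mod_cat A)). labels A B \<alpha>) \<longleftrightarrow>
           left_modular (tors A) \<T>)"
proof -
  interpret fin_dim_algebra K A by fact
  have T: "\<T> \<in> torsion_classes A" and F: "\<F> = right_perp A \<T>"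
    using assms(2) unfolding torsion_classes_def torsion_pair_def by blast+
  \<comment> \<open>All three conditions are compared with this dichotomy for bricks, the labelling
    condition one brick at a time.\<close>
  have split: "brick_splitting A \<T> \<F> \<longleftrightarrow> (\<forall>B\<in>bricks A. B \<in> \<T> \<or> B \<in> right_perp A \<T>)"
    using assms(2) F by (simp add: brick_splitting_def)
  have label: "(\<exists>\<alpha>\<in>hasse_arrows (tors_interval A (zero_mods A) \<T>)
      \<union> hasse_arrows (tors_interval A \<T> (mod_cat A)). labels A B \<alpha>) \<longleftrightarrow>
      B \<in> \<T> \<or> B \<in> right_perp A \<T>" (is "?l \<longleftrightarrow> ?r") if B: "B \<in> bricks A" for B
  proof
    assume ?l
    then obtain \<V> \<U> where "(\<V>, \<U>) \<in> hasse_arrows (tors_interval A (zero_mods A) \<T>) \<or>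
        (\<V>, \<U>) \<in> hasse_arrows (tors_interval A \<T> (mod_cat A))"
      "B \<in> \<V>" "B \<in> right_perp A \<U>"
      by (auto simp: labels_def)
    \<comment> \<open>The upper end of an arrow of the lower interval lies inside
      \<open>\<T>\<close>, so its label does as well. The lower end of an arrow of the upper
      interval contains \<open>\<T>\<close>, so its label is orthogonal to
      \<open>\<T>\<close>.\<close>
    then show ?r
      unfolding hasse_arrow_tors_interval_iff using right_perp_antimono[of \<T> \<U> A] by blast
  next
    assume ?r
    then show ?l using brick_labels_arrow_below[OF B T] brick_labels_arrow_above[OF B T] by blast
  qed
  have "left_modular (tors A) \<T> \<longleftrightarrow> (\<forall>B\<in>bricks A. B \<in> \<T> \<or> B \<in> right_perp A \<T>)"
    using brick_splitting_left_modular[OF T] left_modular_brick_splitting[OF T] by blast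
  then show ?thesis using split label by simp
qed

end
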